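(* Let $G$ be a $d$-regular graph and $L$ a positive integer such that the system $s\cdot\chi_C=1$ for every even cycle $C$ of $G$ of length $\le L$ is consistent over $\mathbb F_2$; let $W$ be the span of the vectors $\chi_C$ of these constraint cycles, let $\mathcal F$ be the family of switching classes of signings solving the system, and let $\pi\colon W\to\mathbb F_2$ be the linear form with $\pi(\chi_C)=1$ for every constraint cycle $C$. For a prime $p$ with $z(p)\in W$ put $\varepsilon_p=(-1)^{\pi(z(p))}$, and let $B$ be the unsigned non-backtracking operator of $G$. Then for $|u|<\tfrac1{d-1}$, $$\mathbb E_{\sigma\in\mathcal F}\,\log\det(I-uB_\sigma)=\tfrac12\log\det(I-u^2B)-\tfrac12\sum_{p\,:\,z(p)\in W}\log\frac{1+\varepsilon_pu^{|p|}}{1-\varepsilon_pu^{|p|}},$$ where the sum runs over all primes $p$ with $z(p)\in W$ and $\mathbb E_{\sigma\in\mathcal F}$ is the uniform average over $\mathcal F$.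
   Context: $G=(V,E)$ is a finite simple connected graph. A signing is $\sigma\in\{\pm1\}^E$, encoded by $s\in\mathbb F_2^E$ with $\sigma_e=(-1)^{s_e}$; switching at a vertex negates all edges at it. For a cycle $C$, $\chi_C\in\mathbb F_2^E$ is the indicator vector of its edge set; even cycles are cycles of even length. When the system is consistent, the form $\pi$, $\pi(\sum_{C\in S}\chi_C)=|S|\bmod2$, is well defined on $W$. The signed non-backtracking operator $B_\sigma$ acts on the $2|E|$ directed edges: $(B_\sigma)_{e,f}=\sigma_f$ if the head of $e$ is the tail of $f$ and $f\ne\bar e$ (where $\bar e$ is the reversal of $e$, and a directed edge carries the sign of its underlying edge), and $0$ otherwise; $B$ is the case $\sigma\equiv1$. $\det(I-uB_\sigma)$ depends only on the switching class of $\sigma$. A prime $p$ is a cyclic class (closed walks up to cyclic shift of the starting point) of primitive closed non-backtracking walks (non-backtracking also at the wrap; primitive means not a proper power of a shorter closed walk); $|p|$ is its length, and $z(p)\in\mathbb F_2^E$ is the vector of edge traversal multiplicities modulo $2$. Logarithms are the analytic branches vanishing at $u=0$. *)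

theory Defs
  imports
    "HOL-Complex_Analysis.Complex_Analysis"
    "HOL-Library.Z2"
    "HOL-Library.Function_Algebras"
    "Jordan_Normal_Form.Determinant"
begin

text \<open>
  Both \<open>HOL-Analysis\<close> and \<open>Jordan_Normal_Form\<close> provide determinants, matrices and
  the dollar notation; here all matrices are those of \<open>Jordan_Normal_Form\<close>.
\<close>

definition simple_graph :: "'a set \<Rightarrow> 'a set set \<Rightarrow> bool" where
  "simple_graph V E \<longleftrightarrow> finite V \<and> (\<forall>e\<in>E. e \<subseteq> V \<and> card e = 2)"

definition arcs :: "'a set set \<Rightarrow> ('a \<times> 'a) set" where
  "arcs E = {(x, y). {x, y} \<in> E}"

definition connected_graph :: "'a set \<Rightarrow> 'a set set \<Rightarrow> bool" where
  "connected_graph V E \<longleftrightarrow> V \<noteq> {} \<and> (\<forall>x\<in>V. \<forall>y\<in>V. (x, y) \<in> (arcs E)\<^sup>*)"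

definition regular_graph :: "'a set \<Rightarrow> 'a set set \<Rightarrow> nat \<Rightarrow> bool" where
  "regular_graph V E d \<longleftrightarrow> (\<forall>v\<in>V. card {e \<in> E. v \<in> e} = d)"

definition closed_path_edges :: "'a list \<Rightarrow> 'a set set" where
  "closed_path_edges vs = {{vs ! i, vs ! (Suc i mod length vs)} | i. i < length vs}"

text \<open>A cycle is identified with its edge set, so the length of \<open>C\<close> is \<open>card C\<close>.\<close>

definition is_cycle :: "'a set set \<Rightarrow> 'a set set \<Rightarrow> bool" where
  "is_cycle E C \<longleftrightarrow>
     (\<exists>vs. distinct vs \<and> 3 \<le> length vs \<and> C = closed_path_edges vs \<and> C \<subseteq> E)"

definition constraint_cycles :: "'a set set \<Rightarrow> nat \<Rightarrow> 'a set set set" where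
  "constraint_cycles E L = {C. is_cycle E C \<and> even (card C) \<and> card C \<le> L}"

text \<open>Edge vectors are functions into \<^typ>\<open>bit\<close> that vanish off \<open>E\<close>, with pointwise addition.\<close>

definition edge_vectors :: "'a set set \<Rightarrow> ('a set \<Rightarrow> bit) set" where
  "edge_vectors E = {s. \<forall>e. e \<notin> E \<longrightarrow> s e = 0}"

definition bit_scale :: "bit \<Rightarrow> ('b \<Rightarrow> bit) \<Rightarrow> 'b \<Rightarrow> bit" where
  "bit_scale c x = (\<lambda>e. c * x e)"

global_interpretation bitvec: vector_space bit_scale
  by standard (auto simp: bit_scale_def fun_eq_iff algebra_simps)

definition chi :: "'b set \<Rightarrow> 'b \<Rightarrow> bit" where
  "chi C = (\<lambda>e. if e \<in> C then 1 else 0)"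

definition solutions :: "'a set set \<Rightarrow> nat \<Rightarrow> ('a set \<Rightarrow> bit) set" where
  "solutions E L =
     {s \<in> edge_vectors E. \<forall>C\<in>constraint_cycles E L. (\<Sum>e\<in>E. s e * chi C e) = 1}"

definition consistent :: "'a set set \<Rightarrow> nat \<Rightarrow> bool" where
  "consistent E L \<longleftrightarrow> solutions E L \<noteq> {}"

definition constraint_span :: "'a set set \<Rightarrow> nat \<Rightarrow> ('a set \<Rightarrow> bit) set" where
  "constraint_span E L = bitvec.span (chi ` constraint_cycles E L)"

definition linear_form_on :: "('b \<Rightarrow> bit) set \<Rightarrow> (('b \<Rightarrow> bit) \<Rightarrow> bit) \<Rightarrow> bool" where
  "linear_form_on W \<phi> \<longleftrightarrow>
     (\<forall>x\<in>W. \<forall>y\<in>W. \<phi> (x + y) = \<phi> x + \<phi> y) \<and> (\<forall>c. \<forall>x\<in>W. \<phi> (bit_scale c x) = c * \<phi> x)"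

definition pm_one :: "bit \<Rightarrow> complex" where
  "pm_one b = (if b = 1 then - 1 else 1)"

definition switch_at :: "'a set set \<Rightarrow> 'a \<Rightarrow> ('a set \<Rightarrow> bit) \<Rightarrow> 'a set \<Rightarrow> bit" where
  "switch_at E v s = s + chi {e \<in> E. v \<in> e}"

text \<open>Since switching twice at a vertex is the identity, the reflexive transitive closure
  is already symmetric.\<close>

definition switching_rel :: "'a set \<Rightarrow> 'a set set \<Rightarrow> (('a set \<Rightarrow> bit) \<times> ('a set \<Rightarrow> bit)) set" where
  "switching_rel V E = {(s, switch_at E v s) | s v. v \<in> V}\<^sup>*"

definition solution_classes :: "'a set \<Rightarrow> 'a set set \<Rightarrow> nat \<Rightarrow> ('a set \<Rightarrow> bit) set set" where
  "solution_classes V E L = solutions E L // switching_rel V E"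

text \<open>
  The value of a function on classes that is given on representatives; meaningful only when
  \<open>f\<close> is constant on \<open>c\<close>.
\<close>

definition class_value :: "('b \<Rightarrow> 'c) \<Rightarrow> 'b set \<Rightarrow> 'c" where
  "class_value f c = the_elem (f ` c)"

definition average :: "'b set \<Rightarrow> ('b \<Rightarrow> complex) \<Rightarrow> complex" where
  "average A f = (\<Sum>x\<in>A. f x) / of_nat (card A)"

definition undir_edge :: "'a \<times> 'a \<Rightarrow> 'a set" where
  "undir_edge a = {fst a, snd a}"

definition nb_step :: "'a \<times> 'a \<Rightarrow> 'a \<times> 'a \<Rightarrow> bool" where
  "nb_step a b \<longleftrightarrow> snd a = fst b \<and> b \<noteq> prod.swap a"

text \<open>
  The matrix with respect to an enumeration \<open>es\<close> of the directed edges. The unsigned operator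
  is the case \<open>s = 0\<close>.
\<close>

definition nb_matrix :: "('a \<times> 'a) list \<Rightarrow> ('a set \<Rightarrow> bit) \<Rightarrow> complex mat" where
  "nb_matrix es s = mat (length es) (length es)
     (\<lambda>(i, j). if nb_step (es ! i) (es ! j) then pm_one (s (undir_edge (es ! j))) else 0)"

definition nb_det :: "('a \<times> 'a) list \<Rightarrow> ('a set \<Rightarrow> bit) \<Rightarrow> complex \<Rightarrow> complex" where
  "nb_det es s u =
     Determinant.det (1\<^sub>m (length es) + (- u) \<cdot>\<^sub>m nb_matrix es s)"

definition closed_walk :: "'a set set \<Rightarrow> ('a \<times> 'a) list \<Rightarrow> bool" where
  "closed_walk E p \<longleftrightarrow> p \<noteq> [] \<and> set p \<subseteq> arcs E \<and>
     (\<forall>i<length p. snd (p ! i) = fst (p ! (Suc i mod length p)))"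

definition closed_nb_walk :: "'a set set \<Rightarrow> ('a \<times> 'a) list \<Rightarrow> bool" where
  "closed_nb_walk E p \<longleftrightarrow> closed_walk E p \<and>
     (\<forall>i<length p. p ! (Suc i mod length p) \<noteq> prod.swap (p ! i))"

definition primitive_walk :: "'a set set \<Rightarrow> ('a \<times> 'a) list \<Rightarrow> bool" where
  "primitive_walk E p \<longleftrightarrow>
     \<not> (\<exists>q m. closed_walk E q \<and> 1 < m \<and> p = concat (replicate m q))"

definition rotation_rel :: "('b list \<times> 'b list) set" where
  "rotation_rel = {(p, q). \<exists>n. q = rotate n p}"

definition nb_primes :: "'a set set \<Rightarrow> ('a \<times> 'a) list set set" where
  "nb_primes E = {p. closed_nb_walk E p \<and> primitive_walk E p} // rotation_rel"

definition nb_prime_length :: "('a \<times> 'a) list set \<Rightarrow> nat" where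
  "nb_prime_length P = class_value length P"

definition traversal_vector :: "('a \<times> 'a) list set \<Rightarrow> 'a set \<Rightarrow> bit" where
  "traversal_vector P =
     class_value (\<lambda>p e. of_nat (count_list (map undir_edge p) e)) P"

text \<open>
  The analytic branch on \<open>D\<close> of \<open>log \<circ> f\<close> that vanishes at \<open>0\<close>. For connected open \<open>D\<close>
  containing \<open>0\<close> its values on \<open>D\<close> are unique; such a branch exists when moreover \<open>D\<close> is
  simply connected, \<open>f\<close> is holomorphic and zero-free on \<open>D\<close>, and \<open>f 0 = 1\<close>.
\<close>

definition log_branch :: "complex set \<Rightarrow> (complex \<Rightarrow> complex) \<Rightarrow> complex \<Rightarrow> complex" where
  "log_branch D f =
     (SOME g. g holomorphic_on D \<and> g 0 = 0 \<and> (\<forall>w\<in>D. exp (g w) = f w))"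

text \<open>
  The region \<open>\<bar>u\<bar> < 1 / (d - 1)\<close>, written without division so that it is the whole plane
  for \<open>d = 1\<close>, where \<open>1 / (d - 1)\<close> means infinity.
\<close>

definition nb_disc :: "nat \<Rightarrow> complex set" where
  "nb_disc d = {u. (real d - 1) * cmod u < 1}"

end

theory Submission
  imports Defs "Jordan_Normal_Form.Schur_Decomposition"
begin

text \<open>
  Since the traces of the powers of \<open>B\<^sub>\<sigma>\<close> count closed non-backtracking walks with their
  signs, \<open>- log det (I - u B\<^sub>\<sigma>)\<close> is the absolutely convergent sum of
  \<open>\<sigma>(p) u\<^bsup>|p|\<^esup> / |p|\<close> over all such walks \<open>p\<close>. Averaging replaces the sign
  \<open>(-1)\<^bsup>s \<cdot> z(p)\<^esup>\<close> by \<open>\<epsilon>\<^sub>p\<close> if \<open>z(p) \<in> W\<close>, and by \<open>0\<close> otherwise: then some \<open>t\<close>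
  orthogonal to \<open>W\<close> has \<open>t \<cdot> z(p) = 1\<close>, and translation by \<open>t\<close> permutes the
  solution classes and flips the sign.
  Every closed walk is uniquely a power \<open>q\<^bsup>m\<^esup>\<close> of a primitive one. For even \<open>m\<close> the vector
  \<open>z(q\<^bsup>m\<^esup>)\<close> vanishes, and these terms add up to the expansion of half of
  \<open>log det (I - u\<^sup>2 B)\<close>; for odd \<open>m\<close> it equals \<open>z(q)\<close>, and the odd part of the logarithmic
  series gives the sum over primes.
\<close>

subsection \<open>Powers and rotations of words\<close>

lemma length_concat_replicate [simp]: "length (concat (replicate m q)) = m * length q"
  by (induction m) auto

lemma nth_concat_replicate:
  "i < m * length q \<Longrightarrow> concat (replicate m q) ! i = q ! (i mod length q)"
proof (induction m arbitrary: i)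
  case (Suc m)
  show ?case
  proof (cases "i < length q")
    case False
    then have "i - length q < m * length q" using Suc.prems by auto
    then show ?thesis using Suc.IH[of "i - length q"] False
      by (simp add: nth_append le_mod_geq)
  qed (simp add: nth_append)
qed simp

lemma concat_replicate_shift:
  "p @ concat (replicate m p) = concat (replicate m p) @ p"
  by (induction m) auto

lemma concat_replicate_mult:
  "concat (replicate m (concat (replicate n q))) = concat (replicate (m * n) q)"
  by (induction m) (auto simp: replicate_add)

text \<open>Requiring \<open>m = 1\<close>, and not merely excluding \<open>m > 1\<close>, also
  rules out the empty word, which is its own zeroth power. The root \<open>q\<close> ranges over all
  words, so the notion does not refer to a graph.\<close>

definition primitive_word :: "'b list \<Rightarrow> bool" where
  "primitive_word p \<longleftrightarrow> (\<forall>q m. p = concat (replicate m q) \<longrightarrow> m = 1)"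

lemma primitive_word_nonempty: "primitive_word p \<Longrightarrow> p \<noteq> []"
proof
  assume "primitive_word p" "p = []"
  then have "p = concat (replicate 0 p)" by simp
  with \<open>primitive_word p\<close> have "(0::nat) = 1" unfolding primitive_word_def by blast
  then show False by simp
qed

lemma primitive_root_exists:
  "p \<noteq> [] \<Longrightarrow> \<exists>q m. 0 < m \<and> primitive_word q \<and> p = concat (replicate m q)"
proof (induction "length p" arbitrary: p rule: less_induct)
  case less
  show ?case
  proof (cases "primitive_word p")
    case True
    then show ?thesis by (intro exI[of _ p] exI[of _ 1]) simp
  next
    case False
    then obtain q m where q: "p = concat (replicate m q)" "m \<noteq> 1"
      unfolding primitive_word_def by blast
    with less.prems have m: "1 < m" "q \<noteq> []" by (cases m; auto)+
    then have "length q < length p" using q by simp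
    from less.hyps[OF this m(2)] obtain r k
      where r: "0 < k" "primitive_word r" "q = concat (replicate k r)" by blast
    then show ?thesis using q m
      by (intro exI[of _ r] exI[of _ "m * k"]) (auto simp: concat_replicate_mult)
  qed
qed

text \<open>The common power \<open>w\<close> commutes with \<open>p\<close> and with
  \<open>q\<close>. Rewriting \<open>w @ w\<close> with one copy of each word moved to the front
  shows that it begins both with \<open>p @ q\<close> and with \<open>q @ p\<close>; these prefixes
  have equal length.\<close>

lemma concat_replicate_eq_imp_comm:
  assumes eq: "concat (replicate m p) = concat (replicate n q)" and "0 < m" "0 < n"
  shows "p @ q = q @ p"
proof -
  obtain m' n' where m: "m = Suc m'" and n: "n = Suc n'"
    using assms by (meson gr0_implies_Suc)
  define w where "w = concat (replicate m p)"
  have wp: "w = p @ concat (replicate m' p)" by (simp add: w_def m)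
  have wq: "w = q @ concat (replicate n' q)" using eq by (simp add: w_def n)
  have "p @ w = w @ p" by (simp add: w_def concat_replicate_shift)
  then have 1: "w @ w = (p @ q) @ concat (replicate n' q) @ concat (replicate m' p)"
    by (metis append.assoc wp wq)
  have "q @ w = w @ q" using eq by (simp add: w_def concat_replicate_shift)
  then have 2: "w @ w = (q @ p) @ concat (replicate m' p) @ concat (replicate n' q)"
    by (metis append.assoc wp wq)
  have "length (p @ q) = length (q @ p)" by simp
  with 1 2 show ?thesis by (metis append_eq_append_conv)
qed

text \<open>Words with a common power commute, and commuting words are powers of one word
  \<open>r\<close>. Primitivity forces both exponents to be 1, and comparing lengths then identifies
  \<open>m\<close> and \<open>n\<close>.\<close>

lemma primitive_root_unique:
  assumes "primitive_word p" "primitive_word q" "0 < m" "0 < n"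
    and eq: "concat (replicate m p) = concat (replicate n q)"
  shows "p = q \<and> m = n"
proof -
  obtain i j r where r: "concat (replicate i r) = p" "concat (replicate j r) = q"
    using comm_append_are_replicate[OF concat_replicate_eq_imp_comm[OF eq assms(3,4)]] by blast
  then have "i = 1" "j = 1" using assms(1,2) unfolding primitive_word_def by blast+
  then have pq: "p = q" using r by simp
  have "m * length p = n * length p"
    using arg_cong[OF eq, of length] pq by simp
  then show ?thesis using pq primitive_word_nonempty[OF assms(1)] by simp
qed

section \<open>Rotations of primitive words\<close>

lemma rotate_concat_replicate:
  "rotate n (concat (replicate m q)) = concat (replicate m (rotate n q))"
proof (rule nth_equalityI)
  fix i assume "i < length (rotate n (concat (replicate m q)))"
  then have i: "i < m * length q" by simp
  then have q: "0 < length q" by (cases q) auto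
  have "((n + i) mod (m * length q)) < m * length q" using i by (intro mod_less_divisor) linarith
  then show "rotate n (concat (replicate m q)) ! i = concat (replicate m (rotate n q)) ! i"
    using i q by (simp add: nth_rotate nth_concat_replicate mod_mod_cancel mod_simps)
qed simp

lemma rotate_inverse: "\<exists>k. rotate k (rotate n p) = p"
proof (cases "p = []")
  case False
  then have "n mod length p \<le> length p" by (simp add: less_imp_le)
  then have "(length p - n mod length p + n) mod length p = 0"
    using False by (metis le_add_diff_inverse2 mod_add_right_eq mod_self)
  then show ?thesis by (metis rotate_rotate rotate_id)
qed simp

lemma primitive_word_rotate:
  assumes "primitive_word p" shows "primitive_word (rotate n p)"
  unfolding primitive_word_def
proof (intro allI impI)
  fix q m assume "rotate n p = concat (replicate m q)"
  moreover obtain k where "rotate k (rotate n p) = p" using rotate_inverse by blast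
  ultimately have "p = concat (replicate m (rotate k q))" by (simp add: rotate_concat_replicate)
  then show "m = 1" using assms unfolding primitive_word_def by blast
qed

text \<open>If a rotation fixes \<open>p\<close>, the two nonempty pieces into which it cuts
  \<open>p\<close> commute, so \<open>p\<close> would be a proper power.\<close>

lemma primitive_word_rotate_neq:
  assumes "primitive_word p" "0 < n" "n < length p"
  shows "rotate n p \<noteq> p"
proof
  assume "rotate n p = p"
  then have "drop n p @ take n p = take n p @ drop n p"
    using assms by (simp add: rotate_drop_take)
  moreover have "take n p \<noteq> []" "drop n p \<noteq> []" using assms by auto
  ultimately obtain k zs where "1 < k" "concat (replicate k zs) = take n p @ drop n p"
    by (metis comm_append_is_replicate)
  then show False using assms(1) unfolding primitive_word_def by (metis append_take_drop_id less_irrefl)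
qed

lemma inj_on_rotate_primitive_word:
  assumes "primitive_word p"
  shows "inj_on (\<lambda>n. rotate n p) {..<length p}"
proof -
  have "i = j" if "i < length p" "j < length p" "i \<le> j" "rotate i p = rotate j p" for i j
  proof (rule ccontr)
    note ij = that
    assume "i \<noteq> j"
    \<comment> \<open>Undoing the common rotation by \<open>i\<close> turns the coincidence of two
      rotations into a rotation by \<open>j - i\<close> that fixes \<open>p\<close>.\<close>
    have "rotate i (rotate (j - i) p) = rotate i p"
      using that by (simp add: rotate_rotate)
    moreover obtain k where "\<And>q::'a list. length q = length p \<Longrightarrow> rotate k (rotate i q) = q"
    proof
      fix q :: "'a list" assume "length q = length p"
      then show "rotate (length p - i) (rotate i q) = q"
        unfolding rotate_rotate using ij by (intro rotate_id) simp
    qed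
    ultimately have "rotate (j - i) p = p" by (metis length_rotate)
    then show False using primitive_word_rotate_neq[OF assms, of "j - i"] that \<open>i \<noteq> j\<close> by auto
  qed
  then show ?thesis by (intro inj_onI) (metis lessThan_iff nat_le_linear)
qed

lemma rotation_rel_Image:
  assumes "p \<noteq> []"
  shows "rotation_rel `` {p} = (\<lambda>n. rotate n p) ` {..<length p}"
proof -
  have "rotate n p \<in> (\<lambda>n. rotate n p) ` {..<length p}" for n
    using assms by (subst rotate_conv_mod) auto
  then show ?thesis unfolding rotation_rel_def by auto
qed

lemma equiv_rotation_rel: "equiv UNIV rotation_rel"
proof (rule equivI)
  show "refl rotation_rel"
    unfolding rotation_rel_def by (auto intro!: refl_onI exI[of _ 0])
  show "sym rotation_rel"
    unfolding rotation_rel_def by (auto intro!: symI) (metis rotate_inverse)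
  show "trans rotation_rel"
    unfolding rotation_rel_def by (auto intro!: transI) (metis rotate_rotate)
qed auto

subsection \<open>Closed walks\<close>

text \<open>Closed walks and closed non-backtracking walks differ only in the relation
  \<open>R\<close> between cyclically consecutive arcs, so powers and rotations are treated once for
  both.\<close>

definition cyclic_chain :: "('b \<Rightarrow> 'b \<Rightarrow> bool) \<Rightarrow> 'b list \<Rightarrow> bool" where
  "cyclic_chain R p \<longleftrightarrow> (\<forall>i<length p. R (p ! i) (p ! (Suc i mod length p)))"

text \<open>The junction between two copies of \<open>q\<close> shows the same pair of letters as
  the wrap of \<open>q\<close> itself, so the power and its root have the same cyclically
  consecutive pairs.\<close>

lemma cyclic_chain_concat_replicate:
  assumes "0 < m"
  shows "cyclic_chain R (concat (replicate m q)) \<longleftrightarrow> cyclic_chain R q"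
proof (cases "q = []")
  case False
  let ?l = "length q"
  have l: "0 < ?l" using False by simp
  have step: "concat (replicate m q) ! (Suc i mod (m * ?l)) = q ! (Suc (i mod ?l) mod ?l)" for i
    using l assms by (subst nth_concat_replicate) (auto simp: mod_mod_cancel mod_Suc_eq)
  have "cyclic_chain R (concat (replicate m q)) \<longleftrightarrow>
      (\<forall>i<m * ?l. R (q ! (i mod ?l)) (q ! (Suc (i mod ?l) mod ?l)))"
    unfolding cyclic_chain_def by (simp add: step nth_concat_replicate)
  also have "\<dots> \<longleftrightarrow> cyclic_chain R q"
    unfolding cyclic_chain_def
  proof (intro iffI allI impI)
    fix i assume "\<forall>i<m * ?l. R (q ! (i mod ?l)) (q ! (Suc (i mod ?l) mod ?l))" "i < ?l"
    moreover have "?l \<le> m * ?l" using assms by simp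
    ultimately show "R (q ! i) (q ! (Suc i mod ?l))"
      by (metis mod_less order.strict_trans2)
  qed (use l in simp)
  finally show ?thesis .
qed (simp add: cyclic_chain_def)

lemma cyclic_chain_rotate:
  assumes "cyclic_chain R p" shows "cyclic_chain R (rotate n p)"
  unfolding cyclic_chain_def
proof (intro allI impI)
  fix i assume "i < length (rotate n p)"
  then have i: "i < length p" "Suc i mod length p < length p" "(n + i) mod length p < length p"
    by (auto intro!: mod_less_divisor intro: le_less_trans[OF le0])
  from assms have "R (p ! ((n + i) mod length p)) (p ! (Suc ((n + i) mod length p) mod length p))"
    unfolding cyclic_chain_def using i by blast
  then show "R (rotate n p ! i) (rotate n p ! (Suc i mod length (rotate n p)))"
    using i by (simp add: nth_rotate mod_simps)
qed

lemma closed_walk_iff: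
  "closed_walk E p \<longleftrightarrow> p \<noteq> [] \<and> set p \<subseteq> arcs E \<and> cyclic_chain (\<lambda>a b. snd a = fst b) p"
  unfolding closed_walk_def cyclic_chain_def by simp

lemma closed_nb_walk_iff:
  "closed_nb_walk E p \<longleftrightarrow> p \<noteq> [] \<and> set p \<subseteq> arcs E \<and> cyclic_chain nb_step p"
  unfolding closed_nb_walk_def closed_walk_def cyclic_chain_def nb_step_def by auto

lemma closed_nb_walk_concat_replicate:
  "0 < m \<Longrightarrow> closed_nb_walk E (concat (replicate m q)) \<longleftrightarrow> closed_nb_walk E q"
  unfolding closed_nb_walk_iff by (auto simp: cyclic_chain_concat_replicate)

lemma closed_nb_walk_rotate: "closed_nb_walk E p \<Longrightarrow> closed_nb_walk E (rotate n p)"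
  unfolding closed_nb_walk_iff by (simp add: cyclic_chain_rotate)

text \<open>Any root of a closed walk is again a closed walk, so restricting the roots to closed
  walks changes nothing; exponent 0 is impossible because \<open>p\<close> is nonempty.\<close>

lemma primitive_walk_iff:
  assumes "closed_walk E p"
  shows "primitive_walk E p \<longleftrightarrow> primitive_word p"
proof
  assume prim: "primitive_walk E p"
  show "primitive_word p"
    unfolding primitive_word_def
  proof (intro allI impI)
    fix q m assume p: "p = concat (replicate m q)"
    then have m: "0 < m" using assms by (cases m) (auto simp: closed_walk_iff)
    then have "closed_walk E q"
      using assms unfolding p closed_walk_iff by (auto simp: cyclic_chain_concat_replicate)
    with prim p have "\<not> 1 < m" unfolding primitive_walk_def by blast
    with m show "m = 1" by simp
  qed
next
  assume "primitive_word p"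
  then show "primitive_walk E p" unfolding primitive_word_def primitive_walk_def by fastforce
qed

section \<open>Primitive non-backtracking walks and primes\<close>

definition primitive_nb_walks :: "'a set set \<Rightarrow> ('a \<times> 'a) list set" where
  "primitive_nb_walks E = {p. closed_nb_walk E p \<and> primitive_word p}"

lemma nb_primes_eq: "nb_primes E = primitive_nb_walks E // rotation_rel"
proof -
  have "{p. closed_nb_walk E p \<and> primitive_walk E p} = primitive_nb_walks E"
    unfolding primitive_nb_walks_def by (auto simp: closed_nb_walk_def primitive_walk_iff)
  then show ?thesis unfolding nb_primes_def by simp
qed

lemma rotate_primitive_nb_walk: "p \<in> primitive_nb_walks E \<Longrightarrow> rotate n p \<in> primitive_nb_walks E"
  by (simp add: primitive_nb_walks_def closed_nb_walk_rotate primitive_word_rotate)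

text \<open>Combines existence and uniqueness of primitive roots with the fact that non-backtracking
  passes between a word and its powers. It turns a sum over walks into a double sum over primitive
  walks and exponents.\<close>

lemma bij_betw_primitive_power:
  "bij_betw (\<lambda>(p, m). concat (replicate m p))
     (primitive_nb_walks E \<times> {1..}) {p. closed_nb_walk E p}"
proof (rule bij_betw_imageI)
  show "inj_on (\<lambda>(p, m). concat (replicate m p)) (primitive_nb_walks E \<times> {1..})"
  proof (rule inj_onI)
    fix x y :: "('a \<times> 'a) list \<times> nat"
    assume xy: "x \<in> primitive_nb_walks E \<times> {1..}" "y \<in> primitive_nb_walks E \<times> {1..}"
      and "(\<lambda>(p, m). concat (replicate m p)) x = (\<lambda>(p, m). concat (replicate m p)) y"
    then have "fst x = fst y \<and> snd x = snd y"
      by (intro primitive_root_unique) (auto simp: primitive_nb_walks_def case_prod_unfold)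
    then show "x = y" by (simp add: prod_eq_iff)
  qed
  show "(\<lambda>(p, m). concat (replicate m p)) ` (primitive_nb_walks E \<times> {1..}) = {p. closed_nb_walk E p}"
  proof (intro subset_antisym subsetI)
    fix p assume p: "p \<in> {p. closed_nb_walk E p}"
    then obtain q m where "0 < m" "primitive_word q" "p = concat (replicate m q)"
      using primitive_root_exists[of p] by (auto simp: closed_nb_walk_iff)
    then show "p \<in> (\<lambda>(p, m). concat (replicate m p)) ` (primitive_nb_walks E \<times> {1..})"
      using p by (intro image_eqI[of _ _ "(q, m)"])
        (auto simp: primitive_nb_walks_def closed_nb_walk_concat_replicate)
  qed (auto simp: primitive_nb_walks_def closed_nb_walk_concat_replicate)
qed

lemma nb_primeE:
  assumes "P \<in> nb_primes E"
  obtains p where "p \<in> primitive_nb_walks E" "P = rotation_rel `` {p}"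
  using assms unfolding nb_primes_eq by (auto elim: quotientE)

lemma nb_prime_subset: "P \<in> nb_primes E \<Longrightarrow> P \<subseteq> primitive_nb_walks E"
  by (erule nb_primeE) (auto simp: rotation_rel_def rotate_primitive_nb_walk)

text \<open>The rotations of a primitive word by fewer steps than its length are pairwise distinct.
  This count later cancels the weight \<open>1 / length p\<close> of each walk.\<close>

lemma card_nb_prime:
  assumes "P \<in> nb_primes E" "p \<in> P"
  shows "finite P" "card P = length p"
proof -
  obtain q where q: "q \<in> primitive_nb_walks E" "P = rotation_rel `` {q}"
    using assms(1) by (rule nb_primeE)
  then have prim: "primitive_word q" by (simp add: primitive_nb_walks_def)
  have P: "P = (\<lambda>n. rotate n q) ` {..<length q}"
    using q(2) rotation_rel_Image[OF primitive_word_nonempty[OF prim]] by simp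
  with assms(2) have "length p = length q" by auto
  then show "finite P" "card P = length p"
    unfolding P by (simp_all add: card_image inj_on_rotate_primitive_word[OF prim])
qed

lemma class_value_rotation_class:
  assumes "P \<in> nb_primes E" "p \<in> P" and "\<And>n q. f (rotate n q) = f q"
  shows "class_value f P = f p"
proof -
  obtain q where "P = rotation_rel `` {q}" using assms(1) by (rule nb_primeE)
  then have "f x = f q" if "x \<in> P" for x using that assms(3) by (auto simp: rotation_rel_def)
  then have "f ` P = (\<lambda>_. f p) ` P" using assms(2) by (intro image_cong) metis+
  also have "\<dots> = {f p}" using assms(2) by (rule image_constant)
  finally show ?thesis by (simp add: class_value_def)
qed

lemma nb_prime_length_eq: "P \<in> nb_primes E \<Longrightarrow> p \<in> P \<Longrightarrow> nb_prime_length P = length p"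
  unfolding nb_prime_length_def by (rule class_value_rotation_class) auto

text \<open>Rotation classes partition the primitive walks, so each walk determines its prime. Sums
  over primitive walks can thus be grouped by primes.\<close>

lemma bij_betw_nb_primes:
  "bij_betw snd (Sigma (nb_primes E) (\<lambda>P. P)) (primitive_nb_walks E)"
proof (rule bij_betw_imageI)
  have eq: "P = rotation_rel `` {p}" if P: "P \<in> nb_primes E" "p \<in> P" for P p
  proof -
    obtain q where "P = rotation_rel `` {q}" using P(1) by (rule nb_primeE)
    with P(2) show ?thesis using equiv_class_eq[OF equiv_rotation_rel] by auto
  qed
  show "inj_on snd (Sigma (nb_primes E) (\<lambda>P. P))"
  proof (rule inj_onI)
    fix x y assume "x \<in> Sigma (nb_primes E) (\<lambda>P. P)" "y \<in> Sigma (nb_primes E) (\<lambda>P. P)" "snd x = snd y"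
    then have "fst x = rotation_rel `` {snd x}" "fst y = rotation_rel `` {snd x}"
      using eq by (metis SigmaE fst_conv snd_conv)+
    with \<open>snd x = snd y\<close> show "x = y" by (metis prod_eqI)
  qed
  have "p \<in> rotation_rel `` {p}" for p :: "('a \<times> 'a) list"
    using equiv_rotation_rel by (rule equiv_class_self) simp
  then have "p \<in> snd ` Sigma (nb_primes E) (\<lambda>P. P)" if "p \<in> primitive_nb_walks E" for p
    using that by (intro image_eqI[of _ _ "(rotation_rel `` {p}, p)"])
      (auto simp: nb_primes_eq quotientI)
  then show "snd ` Sigma (nb_primes E) (\<lambda>P. P) = primitive_nb_walks E"
    using nb_prime_subset by fastforce
qed

subsection \<open>Signs of closed walks\<close>

(* Rewriting bit arithmetic into Boolean connectives would hide the linear structure. *)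
declare add_bit_eq_xor [simp del] mult_bit_eq_and [simp del]

lemma pm_one_add: "pm_one (a + b) = pm_one a * pm_one b"
  by (cases a; cases b) (auto simp: pm_one_def)

lemma pm_one_0 [simp]: "pm_one 0 = 1" and pm_one_1 [simp]: "pm_one 1 = -1"
  by (simp_all add: pm_one_def)

lemma norm_pm_one [simp]: "cmod (pm_one b) = 1"
  by (simp add: pm_one_def)

lemma pm_one_power_odd: "odd m \<Longrightarrow> pm_one b ^ m = pm_one b"
  by (simp add: pm_one_def)

lemma bit_add_self [simp]: "(x::bit) + x = 0"
  by (cases x) auto

lemma finite_edges: "simple_graph V E \<Longrightarrow> finite E"
  by (rule finite_subset[of E "Pow V"]) (auto simp: simple_graph_def)

lemma arc_distinct: "simple_graph V E \<Longrightarrow> a \<in> arcs E \<Longrightarrow> fst a \<noteq> snd a"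
  by (cases a) (auto simp: simple_graph_def arcs_def)

lemma undir_edge_in: "a \<in> arcs E \<Longrightarrow> undir_edge a \<in> E"
  by (auto simp: arcs_def undir_edge_def)

section \<open>The pairing of signings with parity vectors of walks\<close>

definition edge_dot :: "'b set \<Rightarrow> ('b \<Rightarrow> bit) \<Rightarrow> ('b \<Rightarrow> bit) \<Rightarrow> bit" where
  "edge_dot E s z = (\<Sum>e\<in>E. s e * z e)"

lemma edge_dot_add_left: "edge_dot E (s + t) z = edge_dot E s z + edge_dot E t z"
  by (simp add: edge_dot_def sum.distrib distrib_right)

lemma edge_dot_add_right: "edge_dot E s (y + z) = edge_dot E s y + edge_dot E s z"
  by (simp add: edge_dot_def sum.distrib distrib_left)

lemma edge_dot_scale_right: "edge_dot E s (bit_scale c z) = c * edge_dot E s z"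
  by (simp add: edge_dot_def bit_scale_def sum_distrib_left mult.left_commute)

text \<open>This is the vector \<open>z(p)\<close> computed on a single walk;
  \<open>traversal_vector\<close> is its common value on a rotation class.\<close>

definition edge_parity :: "('a \<times> 'a) list \<Rightarrow> 'a set \<Rightarrow> bit" where
  "edge_parity p = (\<lambda>e. of_nat (count_list (map undir_edge p) e))"

lemma edge_parity_Cons: "edge_parity (a # p) = chi {undir_edge a} + edge_parity p"
  by (auto simp: edge_parity_def chi_def fun_eq_iff)

lemma edge_parity_append: "edge_parity (p @ q) = edge_parity p + edge_parity q"
  by (auto simp: edge_parity_def fun_eq_iff)

lemma edge_parity_rotate: "edge_parity (rotate n p) = edge_parity p"
proof -
  have "edge_parity (rotate1 q) = edge_parity q" for q :: "('a \<times> 'a) list"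
    by (cases q) (auto simp: edge_parity_append edge_parity_Cons edge_parity_def[of "[]"] fun_eq_iff add.commute)
  then show ?thesis by (induction n) auto
qed

lemma edge_parity_concat_replicate:
  "edge_parity (concat (replicate m p)) = (if even m then 0 else edge_parity p)"
proof (induction m)
  case (Suc m)
  then show ?case by (auto simp: edge_parity_append fun_eq_iff)
qed (simp add: edge_parity_def fun_eq_iff)

lemma traversal_vector_eq: "P \<in> nb_primes E \<Longrightarrow> p \<in> P \<Longrightarrow> traversal_vector P = edge_parity p"
  unfolding traversal_vector_def edge_parity_def[symmetric]
  by (rule class_value_rotation_class) (auto simp: edge_parity_rotate)

lemma edge_parity_in_edge_vectors: "set p \<subseteq> arcs E \<Longrightarrow> edge_parity p \<in> edge_vectors E"
proof (induction p)
  case (Cons a p)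
  then show ?case
    using undir_edge_in[of a E] by (auto simp: edge_vectors_def edge_parity_Cons chi_def)
qed (simp add: edge_vectors_def edge_parity_def)

lemma edge_dot_chi_singleton: "finite E \<Longrightarrow> e \<in> E \<Longrightarrow> edge_dot E s (chi {e}) = s e"
  by (simp add: edge_dot_def chi_def if_distrib cong: if_cong)

text \<open>Both sides are additive when an arc is prepended. After passing to signs, the pairing
  with \<open>z(p)\<close> becomes the product of edge signs along the walk, the form in which it
  occurs in traces.\<close>

lemma edge_dot_edge_parity:
  assumes "finite E" "set p \<subseteq> arcs E"
  shows "edge_dot E s (edge_parity p) = (\<Sum>a\<leftarrow>p. s (undir_edge a))"
  using assms(2)
proof (induction p)
  case (Cons a p)
  then show ?case using assms(1)
    unfolding edge_parity_Cons edge_dot_add_right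
    by (simp add: edge_dot_chi_singleton undir_edge_in)
qed (simp add: edge_parity_def edge_dot_def)

lemma prod_list_pm_one: "(\<Prod>a\<leftarrow>p. pm_one (f a)) = pm_one (\<Sum>a\<leftarrow>p. f a)"
  by (induction p) (auto simp: pm_one_add)

lemma map_snd_eq_rotate1_map_fst:
  assumes "cyclic_chain (\<lambda>a b. snd a = fst b) p"
  shows "map snd p = rotate1 (map fst p)"
  using assms unfolding cyclic_chain_def
  by (intro nth_equalityI) (auto simp: nth_rotate1 intro!: nth_map[symmetric] mod_less_divisor elim: le_less_trans[OF le0])

text \<open>A closed walk enters a vertex as often as it leaves it.\<close>

lemma edge_dot_star:
  assumes "simple_graph V E" "closed_walk E p"
  shows "edge_dot E (chi {e \<in> E. v \<in> e}) (edge_parity p) = 0"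
proof -
  let ?c = "\<lambda>x. of_bool (x = v) :: bit"
  have p: "set p \<subseteq> arcs E" "map snd p = rotate1 (map fst p)"
    using assms(2) by (auto simp: closed_walk_iff map_snd_eq_rotate1_map_fst)
  have "edge_dot E (chi {e \<in> E. v \<in> e}) (edge_parity p) =
      (\<Sum>a\<leftarrow>p. chi {e \<in> E. v \<in> e} (undir_edge a))"
    by (rule edge_dot_edge_parity[OF finite_edges[OF assms(1)] p(1)])
  \<comment> \<open>An arc has distinct ends, so its edge belongs to the star of \<open>v\<close>
    exactly when one of the two indicators is 1.\<close>
  also have "\<dots> = (\<Sum>a\<leftarrow>p. ?c (fst a) + ?c (snd a))"
  proof (rule arg_cong[of _ _ sum_list], rule map_cong[OF refl])
    fix a assume "a \<in> set p"
    then have "a \<in> arcs E" using p by auto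
    then show "chi {e \<in> E. v \<in> e} (undir_edge a) = ?c (fst a) + ?c (snd a)"
      using arc_distinct[OF assms(1), of a] undir_edge_in[of a E]
      by (auto simp: chi_def undir_edge_def)
  qed
  also have "\<dots> = sum_list (map ?c (map fst p)) + sum_list (map ?c (map snd p))"
    by (simp add: sum_list_addf o_def)
  also have "sum_list (map ?c (rotate1 xs)) = sum_list (map ?c xs)" for xs
    by (cases xs) (auto simp: add.commute)
  then have "sum_list (map ?c (map snd p)) = sum_list (map ?c (map fst p))"
    unfolding p(2) .
  finally show ?thesis by simp
qed

text \<open>Each switching adds the star of a vertex, which pairs to 0 with the parity vector of a
  closed walk. The sign of a closed walk is therefore a function of the switching class.\<close>

lemma edge_dot_switching_rel:
  assumes "simple_graph V E" "closed_walk E p" "(s, s') \<in> switching_rel V E"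
  shows "edge_dot E s' (edge_parity p) = edge_dot E s (edge_parity p)"
  using assms(3) unfolding switching_rel_def
proof (induction rule: rtrancl_induct)
  case (step y z)
  then obtain v where "z = y + chi {e \<in> E. v \<in> e}" by (auto simp: switch_at_def)
  with step.IH show ?case
    by (simp only: edge_dot_add_left edge_dot_star[OF assms(1,2)] add_0_right)
qed simp

subsection \<open>Averages over the solution classes\<close>

lemma class_value_switching_class:
  assumes "\<And>s'. (s, s') \<in> switching_rel V E \<Longrightarrow> f s' = f s"
  shows "class_value f (switching_rel V E `` {s}) = f s"
proof -
  have "f ` (switching_rel V E `` {s}) = (\<lambda>_. f s) ` (switching_rel V E `` {s})"
    by (intro image_cong refl assms) simp
  also have "\<dots> = {f s}"
    by (rule image_constant[of s]) (simp add: switching_rel_def)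
  finally show ?thesis by (simp add: class_value_def)
qed

section \<open>Translation of switching classes\<close>

lemma switching_rel_translate:
  "(s, s') \<in> switching_rel V E \<Longrightarrow> (s + t, s' + t) \<in> switching_rel V E"
  unfolding switching_rel_def
proof (induction rule: rtrancl_induct)
  case (step y z)
  from step(2) have "(y + t, z + t) \<in> {(s, switch_at E v s) | s v. v \<in> V}"
    by (auto simp: switch_at_def add_ac)
  with step(3) show ?case by (rule rtrancl_into_rtrancl)
qed simp

lemma bit_vector_add_self: "(t :: 'b \<Rightarrow> bit) + t = 0"
  by (simp add: fun_eq_iff)

lemma bit_vector_add_self_right: "(s :: 'b \<Rightarrow> bit) + t + t = s"
  by (simp add: add.assoc bit_vector_add_self)

text \<open>Switchings are themselves translations and so commute with adding \<open>t\<close>;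
  since \<open>t\<close> is its own negative, the same argument applied backwards gives the reverse
  inclusion.\<close>

lemma image_translate_switching_class:
  "(\<lambda>s'. s' + t) ` (switching_rel V E `` {s}) = switching_rel V E `` {s + t}"
proof (intro subset_antisym subsetI)
  fix x assume "x \<in> switching_rel V E `` {s + t}"
  then have "(s, x + t) \<in> switching_rel V E"
    using switching_rel_translate[of "s + t" x V E t] by (simp add: bit_vector_add_self_right)
  then show "x \<in> (\<lambda>s'. s' + t) ` (switching_rel V E `` {s})"
    by (intro image_eqI[of _ _ "x + t"]) (auto simp: bit_vector_add_self_right)
qed (auto intro: switching_rel_translate)

lemma finite_solution_classes:
  assumes "finite E" shows "finite (solution_classes V E L)"
proof -
  have "finite {f::'a set \<Rightarrow> bit. \<forall>x. (x \<in> E \<longrightarrow> f x \<in> {0, 1}) \<and> (x \<notin> E \<longrightarrow> f x = 0)}"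
    using assms by (intro finite_set_of_finite_funs) auto
  then have "finite (solutions E L)"
    by (rule rev_finite_subset) (auto simp: solutions_def edge_vectors_def)
  then show ?thesis unfolding solution_classes_def quotient_def by simp
qed

lemma solution_classes_nonempty: "consistent E L \<Longrightarrow> solution_classes V E L \<noteq> {}"
  unfolding solution_classes_def consistent_def quotient_def by auto

section \<open>Solutions as linear forms, and separation from the constraint span\<close>

lemma solutions_iff:
  "s \<in> solutions E L \<longleftrightarrow> s \<in> edge_vectors E \<and> (\<forall>C\<in>constraint_cycles E L. edge_dot E s (chi C) = 1)"
  unfolding solutions_def edge_dot_def by simp

text \<open>Pairing with a solution and \<open>\<pi>\<close> are both linear on the span and both
  equal 1 on its generators.\<close>

lemma edge_dot_solution_eq_form:
  assumes s: "s \<in> solutions E L"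
    and \<pi>: "linear_form_on (constraint_span E L) \<pi>" "\<forall>C\<in>constraint_cycles E L. \<pi> (chi C) = 1"
    and z: "z \<in> constraint_span E L"
  shows "edge_dot E s z = \<pi> z"
proof -
  let ?W = "constraint_span E L"
  have W: "bitvec.subspace ?W" unfolding constraint_span_def by (rule bitvec.subspace_span)
  \<comment> \<open>Membership in \<open>?W\<close> is carried along because \<open>\<pi>\<close> is
    assumed linear only there.\<close>
  have "z \<in> ?W \<and> edge_dot E s z = \<pi> z"
    using z unfolding constraint_span_def
  proof (induction rule: bitvec.span_induct)
    case base
    have scale: "\<pi> (bit_scale c x) = c * \<pi> x" and add: "\<pi> (x + y) = \<pi> x + \<pi> y"
      if "x \<in> ?W" "y \<in> ?W" for c x y
      using \<pi>(1) that unfolding linear_form_on_def by blast+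
    have "\<pi> (bit_scale 0 0) = 0" using bitvec.subspace_0[OF W] by (subst scale) auto
    then have zero: "\<pi> 0 = 0" by (simp add: bit_scale_def zero_fun_def)
    show ?case
      unfolding constraint_span_def[symmetric]
    proof (rule bitvec.subspaceI; (elim CollectE conjE)?; intro CollectI conjI)
      show "edge_dot E s 0 = \<pi> 0" by (simp add: zero edge_dot_def)
      show "edge_dot E s (x + y) = \<pi> (x + y)" if "x \<in> ?W" "edge_dot E s x = \<pi> x"
          "y \<in> ?W" "edge_dot E s y = \<pi> y" for x y
        using that by (simp only: add edge_dot_add_right)
      show "edge_dot E s (bit_scale c x) = \<pi> (bit_scale c x)" if "x \<in> ?W" "edge_dot E s x = \<pi> x" for c x
        using that by (simp only: scale edge_dot_scale_right)
    qed (use W in \<open>blast intro: bitvec.subspace_0 bitvec.subspace_add bitvec.subspace_scale\<close>)+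
  next
    case (step x)
    then show ?case
      using s \<pi>(2) by (auto simp: solutions_iff intro: bitvec.span_base)
  qed
  then show ?thesis ..
qed

text \<open>A basis \<open>B\<close> of the span of \<open>S\<close> stays independent when
  \<open>z\<close> is added, so some linear form \<open>g\<close> vanishes on \<open>B\<close> and
  is 1 at \<open>z\<close>. On edge vectors \<open>g\<close> is the pairing with a vector
  \<open>t\<close>.\<close>

lemma separating_edge_vector:
  assumes "finite E" and S: "S \<subseteq> edge_vectors E" and z: "z \<in> edge_vectors E" "z \<notin> bitvec.span S"
  obtains t where "t \<in> edge_vectors E" "\<And>x. x \<in> S \<Longrightarrow> edge_dot E t x = 0" "edge_dot E t z = 1"
proof -
  \<comment> \<open>The target of the linear form: the field of two elements as a vector space over
    itself.\<close>
  interpret bits: vector_space "(*) :: bit \<Rightarrow> bit \<Rightarrow> bit"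
    by standard (auto simp: algebra_simps)
  interpret vector_space_pair "bit_scale :: bit \<Rightarrow> ('a set \<Rightarrow> bit) \<Rightarrow> _" "(*) :: bit \<Rightarrow> bit \<Rightarrow> bit" ..
  obtain B where B: "B \<subseteq> S" "bitvec.independent B" "S \<subseteq> bitvec.span B"
    by (rule bitvec.maximal_independent_subset)
  have zB: "z \<notin> bitvec.span B" using z(2) bitvec.span_mono[OF B(1)] by auto
  then have "z \<notin> B" by (auto intro: bitvec.span_base)
  from linear_independent_extend[OF bitvec.independent_insertI[OF zB B(2)], of "\<lambda>x. if x = z then 1 else 0"]
  obtain g where g: "Vector_Spaces.linear bit_scale (*) g"
      "\<forall>x\<in>insert z B. g x = (if x = z then 1 else 0)"
    by blast
  interpret g: Vector_Spaces.linear bit_scale "(*) :: bit \<Rightarrow> bit \<Rightarrow> bit" g by (rule g(1))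
  \<comment> \<open>The coordinates of \<open>t\<close> are the values of \<open>g\<close> on the
    unit vectors, cut off outside \<open>E\<close> so that \<open>t\<close> is an edge
    vector.\<close>
  define t where "t e = (if e \<in> E then g (chi {e}) else 0)" for e
  have t: "edge_dot E t x = g x" if "x \<in> edge_vectors E" for x
  proof -
    have "(\<Sum>e\<in>F. h e) e' = (\<Sum>e\<in>F. h e e')" for F :: "'a set set" and h :: "'a set \<Rightarrow> 'a set \<Rightarrow> bit" and e'
      by (induction F rule: infinite_finite_induct) auto
    then have "x e' = (\<Sum>e\<in>E. bit_scale (x e) (chi {e})) e'" for e'
      using assms(1) that
      by (auto simp: bit_scale_def chi_def edge_vectors_def if_distrib cong: if_cong)
    then have "g x = g (\<Sum>e\<in>E. bit_scale (x e) (chi {e}))" by (intro arg_cong[of _ _ g] ext)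
    also have "\<dots> = (\<Sum>e\<in>E. x e * g (chi {e}))" by (simp only: g.sum g.scale)
    finally have "g x = (\<Sum>e\<in>E. x e * g (chi {e}))" .
    then show ?thesis by (simp add: edge_dot_def t_def mult.commute)
  qed
  have "g x = 0" if "x \<in> S" for x
  proof -
    have "x \<in> bitvec.span B" using that B(3) by auto
    moreover have "\<forall>x\<in>B. g x = 0" using g(2) \<open>z \<notin> B\<close> by auto
    ultimately show ?thesis using g.eq_0_on_span[of B] by blast
  qed
  show thesis
  proof (rule that[of t])
    show "t \<in> edge_vectors E" by (simp add: edge_vectors_def t_def)
    show "edge_dot E t x = 0" if "x \<in> S" for x
      using that S t[of x] \<open>\<And>x. x \<in> S \<Longrightarrow> g x = 0\<close> by auto
    show "edge_dot E t z = 1" using t[OF z(1)] g(2) by simp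
  qed
qed

lemma average_const: "finite A \<Longrightarrow> A \<noteq> {} \<Longrightarrow> (\<And>x. x \<in> A \<Longrightarrow> f x = c) \<Longrightarrow> average A f = c"
  by (simp add: average_def)

lemma chi_constraint_cycle_in_edge_vectors:
  "C \<in> constraint_cycles E L \<Longrightarrow> chi C \<in> edge_vectors E"
  by (auto simp: constraint_cycles_def is_cycle_def edge_vectors_def chi_def)

lemma average_sign:
  assumes G: "simple_graph V E" and p: "closed_walk E p"
    and "consistent E L"
    and \<pi>: "linear_form_on (constraint_span E L) \<pi>" "\<forall>C\<in>constraint_cycles E L. \<pi> (chi C) = 1"
  shows "average (solution_classes V E L) (class_value (\<lambda>s. pm_one (edge_dot E s (edge_parity p)))) =
    (if edge_parity p \<in> constraint_span E L then pm_one (\<pi> (edge_parity p)) else 0)"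
proof -
  let ?A = "solution_classes V E L" and ?z = "edge_parity p"
  let ?f = "\<lambda>s. pm_one (edge_dot E s ?z)"
  have val: "class_value ?f (switching_rel V E `` {s}) = ?f s" for s
    by (rule class_value_switching_class) (simp add: edge_dot_switching_rel[OF G p])
  have classE: "\<exists>s\<in>solutions E L. c = switching_rel V E `` {s}" if "c \<in> ?A" for c
    using that unfolding solution_classes_def by (auto elim: quotientE)
  show ?thesis
  proof (cases "?z \<in> constraint_span E L")
    case True
    have "average ?A (class_value ?f) = pm_one (\<pi> ?z)"
    proof (rule average_const)
      fix c assume "c \<in> ?A"
      then obtain s where "s \<in> solutions E L" "c = switching_rel V E `` {s}" using classE by blast
      then show "class_value ?f c = pm_one (\<pi> ?z)"
        using edge_dot_solution_eq_form[OF _ \<pi> True] by (simp add: val)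
    qed (use assms in \<open>simp_all add: finite_solution_classes finite_edges solution_classes_nonempty\<close>)
    then show ?thesis using True by simp
  next
    case False
    obtain t where t: "t \<in> edge_vectors E" "\<And>C. C \<in> constraint_cycles E L \<Longrightarrow> edge_dot E t (chi C) = 0"
      "edge_dot E t ?z = 1"
    proof (rule separating_edge_vector[of E "chi ` constraint_cycles E L" ?z])
      show "finite E" using G by (rule finite_edges)
      show "?z \<in> edge_vectors E" using p by (simp add: closed_walk_iff edge_parity_in_edge_vectors)
      show "?z \<notin> bitvec.span (chi ` constraint_cycles E L)"
        using False by (simp add: constraint_span_def)
    qed (use chi_constraint_cycle_in_edge_vectors in auto)
    let ?T = "(`) (\<lambda>s. s + t)"
    have T_class: "?T c \<in> ?A" and T_val: "class_value ?f (?T c) = - class_value ?f c" if c: "c \<in> ?A" for c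
    proof -
      obtain s where s: "s \<in> solutions E L" "c = switching_rel V E `` {s}" using classE[OF c] by blast
      then have "s + t \<in> solutions E L"
        using t by (auto simp: solutions_iff edge_vectors_def edge_dot_add_left)
      then show "?T c \<in> ?A"
        unfolding s(2) image_translate_switching_class solution_classes_def by (rule quotientI)
      show "class_value ?f (?T c) = - class_value ?f c"
        unfolding s(2) image_translate_switching_class val by (simp add: edge_dot_add_left pm_one_add t(3))
    qed
    \<comment> \<open>Translation by \<open>t\<close> is an involution of the classes that negates
      the sign, so the sum equals its own negative.\<close>
    have "(\<Sum>c\<in>?A. class_value ?f c) = (\<Sum>c\<in>?A. - class_value ?f c)"
      by (rule sum.reindex_bij_witness[of _ ?T ?T])
        (auto simp: T_class T_val image_image bit_vector_add_self_right)
    then have "(\<Sum>c\<in>?A. class_value ?f c) = 0" by (simp add: sum_negf)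
    then show ?thesis using False by (simp add: average_def)
  qed
qed

subsection \<open>Traces of matrix powers\<close>

lemma sum_lists_Suc:
  "(\<Sum>xs | set xs \<subseteq> A \<and> length xs = Suc k. f xs) =
   (\<Sum>xs | set xs \<subseteq> A \<and> length xs = k. \<Sum>a\<in>A. f (xs @ [a]))"
proof -
  have "bij_betw (\<lambda>(xs, a). xs @ [a]) ({xs. set xs \<subseteq> A \<and> length xs = k} \<times> A)
      {xs. set xs \<subseteq> A \<and> length xs = Suc k}"
  proof (rule bij_betw_byWitness[where f' = "\<lambda>xs. (butlast xs, last xs)"])
    show "\<forall>xs\<in>{xs. set xs \<subseteq> A \<and> length xs = Suc k}. (\<lambda>(xs, a). xs @ [a]) (butlast xs, last xs) = xs"
      by (auto simp flip: length_0_conv)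
    show "(\<lambda>xs. (butlast xs, last xs)) ` {xs. set xs \<subseteq> A \<and> length xs = Suc k} \<subseteq> 
        {xs. set xs \<subseteq> A \<and> length xs = k} \<times> A"
      by (auto dest: in_set_butlastD intro!: subsetD[OF _ last_in_set] simp flip: length_0_conv)
  qed auto
  then show ?thesis
    by (simp add: sum.reindex_bij_betw[symmetric] sum.cartesian_product case_prod_unfold)
qed

text \<open>The list \<open>xs\<close> holds the \<open>k\<close> interior stops of a path with
  \<open>Suc k\<close> steps from \<open>i\<close> to \<open>j\<close>; the two lists under the
  product give the start and the end of each step.\<close>

lemma pow_mat_Suc_index:
  fixes w :: "nat \<Rightarrow> nat \<Rightarrow> 'b::comm_ring_1"
  assumes "i < n" "j < n"
  shows "(mat n n (\<lambda>(i, j). w i j) ^\<^sub>m Suc k) $$ (i, j) =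
    (\<Sum>xs | set xs \<subseteq> {..<n} \<and> length xs = k.
       \<Prod>t<Suc k. w ((i # xs @ [j]) ! t) ((xs @ [j]) ! t))"
  using assms(2)
proof (induction k arbitrary: j)
  case 0
  have "{xs. set xs \<subseteq> {..<n} \<and> length xs = 0} = {[]}" by auto
  then show ?case using assms 0 by simp
next
  case (Suc k)
  let ?A = "mat n n (\<lambda>(i, j). w i j)"
  let ?W = "\<lambda>xs j. \<Prod>t<Suc (length xs). w ((i # xs @ [j]) ! t) ((xs @ [j]) ! t)"
  have W_snoc: "?W (xs @ [l]) j = ?W xs l * w l j" for xs l
  proof -
    have "(\<Prod>t<Suc (length xs). w ((i # (xs @ [l]) @ [j]) ! t) (((xs @ [l]) @ [j]) ! t)) = ?W xs l"
      by (rule prod.cong) (auto simp: nth_append nth_Cons')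
    then show ?thesis by (simp add: nth_append)
  qed
  have "(?A ^\<^sub>m Suc (Suc k)) $$ (i, j) = (\<Sum>l<n. (?A ^\<^sub>m Suc k) $$ (i, l) * w l j)"
    using assms Suc.prems
    by (subst pow_mat.simps) (simp add: scalar_prod_def atLeast0LessThan del: pow_mat.simps)
  also have "\<dots> = (\<Sum>l<n. \<Sum>xs | set xs \<subseteq> {..<n} \<and> length xs = k. ?W xs l * w l j)"
    by (intro sum.cong refl) (subst Suc.IH; auto simp: sum_distrib_right)
  also have "\<dots> = (\<Sum>xs | set xs \<subseteq> {..<n} \<and> length xs = k. \<Sum>l<n. ?W (xs @ [l]) j)"
    unfolding W_snoc by (rule sum.swap)
  also have "\<dots> = (\<Sum>xs | set xs \<subseteq> {..<n} \<and> length xs = Suc k. ?W xs j)"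
    by (rule sum_lists_Suc[symmetric])
  also have "\<dots> = (\<Sum>xs | set xs \<subseteq> {..<n} \<and> length xs = Suc k.
       \<Prod>t<Suc (Suc k). w ((i # xs @ [j]) ! t) ((xs @ [j]) ! t))"
    by (rule sum.cong) auto
  finally show ?case .
qed

lemma trace_pow_mat:
  fixes w :: "nat \<Rightarrow> nat \<Rightarrow> 'b::comm_ring_1"
  assumes "0 < k"
  shows "(\<Sum>i<n. (mat n n (\<lambda>(i, j). w i j) ^\<^sub>m k) $$ (i, i)) =
    (\<Sum>xs | set xs \<subseteq> {..<n} \<and> length xs = k. \<Prod>t<k. w (xs ! t) (xs ! (Suc t mod k)))"
proof -
  obtain k' where k: "k = Suc k'" using assms by (cases k) auto
  \<comment> \<open>The closing index \<open>i\<close> stands last in the cyclic word, so the step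
    leaving \<open>i\<close> is the first factor of the path product and the last factor of the
    cyclic one.\<close>
  have 1: "(\<Prod>t<k. w ((i # xs @ [i]) ! t) ((xs @ [i]) ! t)) =
      (\<Prod>t<k. w ((xs @ [i]) ! t) ((xs @ [i]) ! (Suc t mod k)))"
    if "length xs = k'" for xs i
  proof -
    have "(\<Prod>t<k. w ((xs @ [i]) ! t) ((xs @ [i]) ! (Suc t mod k))) =
        (\<Prod>t<k'. w ((xs @ [i]) ! t) ((xs @ [i]) ! Suc t)) * w i ((xs @ [i]) ! 0)"
      unfolding k prod.lessThan_Suc
      by (intro arg_cong2[of _ _ _ _ "(*)"] prod.cong) (use that in auto)
    also have "\<dots> = w i ((xs @ [i]) ! 0) * (\<Prod>t<k'. w ((xs @ [i]) ! t) ((xs @ [i]) ! Suc t))"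
      by (rule mult.commute)
    also have "\<dots> = (\<Prod>t<k. w ((i # xs @ [i]) ! t) ((xs @ [i]) ! t))"
      unfolding k by (subst prod.lessThan_Suc_shift) simp
    finally show ?thesis ..
  qed
  have "(\<Sum>i<n. (mat n n (\<lambda>(i, j). w i j) ^\<^sub>m k) $$ (i, i)) =
    (\<Sum>i<n. \<Sum>xs | set xs \<subseteq> {..<n} \<and> length xs = k'. 
       \<Prod>t<k. w ((xs @ [i]) ! t) ((xs @ [i]) ! (Suc t mod k)))"
    unfolding k by (intro sum.cong refl, subst pow_mat_Suc_index)
      (auto intro!: sum.cong simp del: prod.lessThan_Suc simp: 1[unfolded k])
  also have "\<dots> = (\<Sum>xs | set xs \<subseteq> {..<n} \<and> length xs = k'. \<Sum>i<n.
       \<Prod>t<k. w ((xs @ [i]) ! t) ((xs @ [i]) ! (Suc t mod k)))"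
    by (rule sum.swap)
  finally show ?thesis unfolding k by (simp only: sum_lists_Suc)
qed

section \<open>Traces and determinants through a triangular form\<close>

lemma trace_conjugate:
  fixes P M Q :: "'b::comm_ring_1 mat"
  assumes "P \<in> carrier_mat n n" "M \<in> carrier_mat n n" "Q \<in> carrier_mat n n" "Q * P = 1\<^sub>m n"
  shows "(\<Sum>i<n. (P * M * Q) $$ (i, i)) = (\<Sum>i<n. M $$ (i, i))"
proof -
  have "(\<Sum>i<n. (P * M * Q) $$ (i, i)) = (\<Sum>i<n. \<Sum>j<n. \<Sum>l<n. P $$ (i, l) * M $$ (l, j) * Q $$ (j, i))"
  proof (intro sum.cong refl)
    fix i assume i: "i \<in> {..<n}"
    have "(P * M * Q) $$ (i, i) = (\<Sum>j<n. (P * M) $$ (i, j) * Q $$ (j, i))"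
      using i assms(1-3) by (simp add: scalar_prod_def atLeast0LessThan del: assoc_mult_mat)
    also have "\<dots> = (\<Sum>j<n. \<Sum>l<n. P $$ (i, l) * M $$ (l, j) * Q $$ (j, i))"
      using i assms(1-3) by (simp add: scalar_prod_def atLeast0LessThan sum_distrib_right)
    finally show "(P * M * Q) $$ (i, i) = (\<Sum>j<n. \<Sum>l<n. P $$ (i, l) * M $$ (l, j) * Q $$ (j, i))" .
  qed
  also have "\<dots> = (\<Sum>j<n. \<Sum>i<n. \<Sum>l<n. P $$ (i, l) * M $$ (l, j) * Q $$ (j, i))"
    by (rule sum.swap)
  \<comment> \<open>With the sum over \<open>i\<close> innermost, the outer factors combine to an
    entry of \<open>Q * P\<close>, the identity.\<close>
  also have "\<dots> = (\<Sum>j<n. \<Sum>l<n. \<Sum>i<n. P $$ (i, l) * M $$ (l, j) * Q $$ (j, i))"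
    by (intro sum.cong refl sum.swap)
  also have "\<dots> = (\<Sum>j<n. \<Sum>l<n. M $$ (l, j) * (Q * P) $$ (j, l))"
    using assms(1-3) by (auto simp: scalar_prod_def atLeast0LessThan sum_distrib_left ac_simps intro!: sum.cong)
  also have "\<dots> = (\<Sum>j<n. M $$ (j, j))"
    unfolding assms(4) by (intro sum.cong refl) (auto simp: if_distrib cong: if_cong)
  finally show ?thesis .
qed

text \<open>In the sum for an entry on or below the diagonal, every term has a factor strictly below
  the diagonal, except the one with \<open>l = i = j\<close>.\<close>

lemma upper_triangular_pow_mat:
  fixes U :: "'b::comm_ring_1 mat"
  assumes U: "U \<in> carrier_mat n n" "upper_triangular U"
  shows "upper_triangular (U ^\<^sub>m k) \<and> (\<forall>i<n. (U ^\<^sub>m k) $$ (i, i) = U $$ (i, i) ^ k)"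
proof (induction k)
  case 0
  then show ?case using U by (auto intro!: upper_triangularI)
next
  case (Suc k)
  have C: "U ^\<^sub>m k \<in> carrier_mat n n" using U by simp
  have entry: "(U ^\<^sub>m Suc k) $$ (i, j) = (\<Sum>l<n. (U ^\<^sub>m k) $$ (i, l) * U $$ (l, j))" if "i < n" "j < n" for i j
    using that U C by (simp add: scalar_prod_def atLeast0LessThan)
  have zero: "(U ^\<^sub>m k) $$ (i, l) * U $$ (l, j) = 0" if "l < i \<or> j < l" "i < n" "l < n" for i j l
    using that U C Suc.IH upper_triangularD[of U j l] upper_triangularD[of "U ^\<^sub>m k" l i] by auto
  show ?case
  proof (intro conjI allI impI upper_triangularI)
    fix i j assume "j < i" "i < dim_row (U ^\<^sub>m Suc k)"
    then have ij: "i < n" "j < n" "j < i" using U by simp_all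
    have "(U ^\<^sub>m k) $$ (i, l) * U $$ (l, j) = 0" if "l < n" for l
      using that ij by (intro zero) auto
    then show "(U ^\<^sub>m Suc k) $$ (i, j) = 0" using ij by (simp only: entry) simp
  next
    fix i assume i: "i < n"
    have "(\<Sum>l<n. (U ^\<^sub>m k) $$ (i, l) * U $$ (l, i)) = (\<Sum>l\<in>{i}. (U ^\<^sub>m k) $$ (i, l) * U $$ (l, i))"
    proof (rule sum.mono_neutral_right)
      show "\<forall>l\<in>{..<n} - {i}. (U ^\<^sub>m k) $$ (i, l) * U $$ (l, i) = 0"
        using i by (intro ballI zero) auto
    qed (use i in auto)
    then show "(U ^\<^sub>m Suc k) $$ (i, i) = U $$ (i, i) ^ Suc k"
      using i Suc.IH by (simp add: entry del: pow_mat.simps)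
  qed
qed

text \<open>The eigenvalue equation is read at a coordinate \<open>i\<close> where the eigenvector
  has largest modulus; dividing by that positive modulus leaves the row sum.\<close>

lemma eigenvalue_norm_le_row_sum:
  fixes A :: "complex mat"
  assumes A: "A \<in> carrier_mat n n" and row: "\<And>i. i < n \<Longrightarrow> (\<Sum>j<n. cmod (A $$ (i, j))) \<le> r"
    and ev: "eigenvalue A l"
  shows "cmod l \<le> r"
proof -
  obtain v where v: "v \<in> carrier_vec n" "v \<noteq> 0\<^sub>v n" "A *\<^sub>v v = l \<cdot>\<^sub>v v"
    using ev A unfolding eigenvalue_def eigenvector_def by auto
  then obtain i0 where i0: "i0 < n" "vec_index v i0 \<noteq> 0" by (metis eq_vecI carrier_vecD index_zero_vec(1,2))
  obtain i where i: "i < n" "\<And>j. j < n \<Longrightarrow> cmod (vec_index v j) \<le> cmod (vec_index v i)"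
  proof -
    let ?S = "(\<lambda>j. cmod (vec_index v j)) ` {..<n}"
    have "Max ?S \<in> ?S" using i0 by (intro Max_in) auto
    then obtain i where "i < n" "Max ?S = cmod (vec_index v i)" by auto
    then show ?thesis using that[of i] Max_ge[of ?S] by auto
  qed
  have pos: "0 < cmod (vec_index v i)" using i(2)[OF i0(1)] i0(2) by (meson order.strict_trans2 zero_less_norm_iff)
  have "l * vec_index v i = (\<Sum>j<n. A $$ (i, j) * vec_index v j)"
    using arg_cong[OF v(3), of "\<lambda>x. vec_index x i"] i v(1) A by (simp add: scalar_prod_def atLeast0LessThan)
  then have "cmod l * cmod (vec_index v i) = cmod (\<Sum>j<n. A $$ (i, j) * vec_index v j)" by (metis norm_mult)
  also have "\<dots> \<le> (\<Sum>j<n. cmod (A $$ (i, j)) * cmod (vec_index v j))"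
    by (rule order.trans[OF norm_sum]) (simp add: norm_mult)
  also have "\<dots> \<le> (\<Sum>j<n. cmod (A $$ (i, j)) * cmod (vec_index v i))"
    by (intro sum_mono mult_left_mono i(2)) auto
  also have "\<dots> \<le> r * cmod (vec_index v i)"
    unfolding sum_distrib_right[symmetric] using row[OF i(1)] by (intro mult_right_mono) auto
  finally show ?thesis using pos by simp
qed

text \<open>The diagonal of a Schur triangular form serves as \<open>l\<close>: similarity preserves
  the determinant of \<open>I - u A\<close> and the traces of powers, and diagonal entries are roots
  of the characteristic polynomial, hence eigenvalues.\<close>

lemma det_and_traces_via_eigenvalues:
  fixes A :: "complex mat"
  assumes A: "A \<in> carrier_mat n n" and row: "\<And>i. i < n \<Longrightarrow> (\<Sum>j<n. cmod (A $$ (i, j))) \<le> r"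
  obtains l where "\<And>i. i < n \<Longrightarrow> cmod (l i) \<le> r"
    and "\<And>u. Determinant.det (1\<^sub>m n + (- u) \<cdot>\<^sub>m A) = (\<Prod>i<n. 1 - u * l i)"
    and "\<And>k. (\<Sum>i<n. (A ^\<^sub>m k) $$ (i, i)) = (\<Sum>i<n. l i ^ k)"
proof -
  obtain as where "char_poly A = (\<Prod>a\<leftarrow>as. [:- a, 1:])"
    using char_poly_factorized[OF A] by blast
  from schur_decomposition_exists[OF A this]
  obtain U where U: "upper_triangular U" "similar_mat A U" by auto
  then obtain P Q where wit: "similar_mat_wit A U P Q" unfolding similar_mat_def by blast
  note w = similar_mat_witD2[OF A wit]
  define l where "l i = U $$ (i, i)" for i
  show thesis
  proof (rule that[of l])
    fix i assume i: "i < n"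
    have "char_poly A = (\<Prod>a\<leftarrow>diag_mat U. [:- a, 1:])"
      using char_poly_similar[OF U(2)] char_poly_upper_triangular[OF w(5) U(1)] by simp
    moreover have "l i \<in> set (diag_mat U)" using i w(5) by (auto simp: diag_mat_def l_def)
    ultimately have "poly (char_poly A) (l i) = 0"
      by (auto simp: poly_prod_list prod_list_zero_iff image_iff intro!: bexI[of _ "l i"])
    then have "eigenvalue A (l i)" using eigenvalue_root_char_poly[OF A] by simp
    then show "cmod (l i) \<le> r" using eigenvalue_norm_le_row_sum[OF A row] by blast
  next
    fix u
    have "1\<^sub>m n + (- u) \<cdot>\<^sub>m A = P * (1\<^sub>m n + (- u) \<cdot>\<^sub>m U) * Q"
    proof -
      have "P * (1\<^sub>m n + (- u) \<cdot>\<^sub>m U) = P + (- u) \<cdot>\<^sub>m (P * U)"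
        using w by (subst mult_add_distrib_mat[of _ n n _ n]) (auto simp: mult_smult_distrib)
      also have "\<dots> * Q = P * Q + (- u) \<cdot>\<^sub>m (P * U * Q)"
        using w by (subst add_mult_distrib_mat[of _ n n _ _ n]) (auto simp: mult_smult_assoc_mat[of _ n n])
      finally show ?thesis using w by simp
    qed
    then have "similar_mat (1\<^sub>m n + (- u) \<cdot>\<^sub>m A) (1\<^sub>m n + (- u) \<cdot>\<^sub>m U)"
      using w A by (intro similar_matI[of _ _ P Q n]) auto
    then have "Determinant.det (1\<^sub>m n + (- u) \<cdot>\<^sub>m A) = Determinant.det (1\<^sub>m n + (- u) \<cdot>\<^sub>m U)"
      by (rule det_similar)
    also have "\<dots> = prod_list (diag_mat (1\<^sub>m n + (- u) \<cdot>\<^sub>m U))"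
      using w(5) U(1)
      by (intro det_upper_triangular[of _ n] upper_triangularI) (auto dest: upper_triangularD)
    also have "\<dots> = (\<Prod>i<n. 1 - u * l i)"
      using w(5) by (simp add: prod_list_diag_prod atLeast0LessThan l_def)
    finally show "Determinant.det (1\<^sub>m n + (- u) \<cdot>\<^sub>m A) = (\<Prod>i<n. 1 - u * l i)" .
  next
    fix k
    have "(\<Sum>i<n. (A ^\<^sub>m k) $$ (i, i)) = (\<Sum>i<n. (U ^\<^sub>m k) $$ (i, i))"
      unfolding similar_mat_wit_pow_id[OF wit]
      using w by (intro trace_conjugate pow_carrier_mat)
    also have "\<dots> = (\<Sum>i<n. l i ^ k)"
      using upper_triangular_pow_mat[OF w(5) U(1)] by (simp add: l_def)
    finally show "(\<Sum>i<n. (A ^\<^sub>m k) $$ (i, i)) = (\<Sum>i<n. l i ^ k)" .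
  qed
qed

subsection \<open>Logarithms\<close>

text \<open>The chosen branch and \<open>g\<close> are logarithms of the same function, so their
  difference is a continuous map into the discrete set of multiples of \<open>2 * pi * \<i>\<close>.
  On a connected set it is constant, and it vanishes at 0.\<close>

lemma log_branch_eqI:
  assumes D: "connected D" "0 \<in> D" and g: "g holomorphic_on D" "g 0 = 0" "\<And>w. w \<in> D \<Longrightarrow> exp (g w) = f w"
    and u: "u \<in> D"
  shows "log_branch D f u = g u"
proof -
  let ?P = "\<lambda>g. g holomorphic_on D \<and> g 0 = 0 \<and> (\<forall>w\<in>D. exp (g w) = f w)"
  define g' where "g' = log_branch D f"
  have "?P g" using g by blast
  \<comment> \<open>The given \<open>g\<close> witnesses that a branch exists, so the choice
    operator yields one.\<close>
  then have g': "?P g'" unfolding g'_def log_branch_def by (rule someI[of ?P])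
  define h where "h w = g' w - g w" for w
  have "h constant_on D"
  proof (rule continuous_discrete_range_constant[OF D(1)])
    show "continuous_on D h"
      unfolding h_def using g(1) g' by (intro continuous_intros holomorphic_on_imp_continuous_on) auto
    fix x assume x: "x \<in> D"
    have "2 * pi \<le> cmod (h y - h x)" if "y \<in> D" "h y \<noteq> h x" for y
    proof -
      have "exp (h y - h x) = 1"
        using g(3) g' x that(1) by (auto simp: h_def exp_diff simp flip: g(3))
      then obtain n :: int where n: "Re (h y - h x) = 0" "Im (h y - h x) = of_int (2 * n) * pi"
        unfolding exp_eq_1 by auto
      with that(2) have "n \<noteq> 0" by (auto simp: complex_eq_iff)
      then have "1 \<le> \<bar>real_of_int n\<bar>" by linarith
      then have "2 * pi \<le> \<bar>Im (h y - h x)\<bar>" unfolding n(2) by (simp add: abs_mult)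
      then show ?thesis using abs_Im_le_cmod[of "h y - h x"] by linarith
    qed
    then show "\<exists>e>0. \<forall>y. y \<in> D \<and> h y \<noteq> h x \<longrightarrow> e \<le> cmod (h y - h x)"
      by (intro exI[of _ "2 * pi"]) auto
  qed
  then have "h u = h 0" using u D(2) unfolding constant_on_def by metis
  then show ?thesis using g' g(2) by (simp add: h_def g'_def)
qed

section \<open>Explicit branches and series from the principal logarithm\<close>

lemma one_minus_notin_nonpos_Reals: "cmod z < 1 \<Longrightarrow> 1 - z \<notin> \<real>\<^sub>\<le>\<^sub>0"
  using complex_Re_le_cmod[of z] by (auto simp: complex_nonpos_Reals_iff)

text \<open>Each factor stays in the unit disc around 1, away from the cut of \<open>Ln\<close>, so
  the sum of principal logarithms is holomorphic and is the required branch.\<close>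

lemma log_branch_prod:
  assumes D: "connected D" "0 \<in> D" and u: "u \<in> D"
    and f: "\<And>i. i \<in> I \<Longrightarrow> f i holomorphic_on D" "\<And>i. i \<in> I \<Longrightarrow> f i 0 = 0"
    and less: "\<And>i w. i \<in> I \<Longrightarrow> w \<in> D \<Longrightarrow> cmod (f i w) < 1"
  shows "log_branch D (\<lambda>w. \<Prod>i\<in>I. 1 - f i w) u = (\<Sum>i\<in>I. Ln (1 - f i u))"
proof (rule log_branch_eqI[OF D _ _ _ u])
  show "(\<lambda>w. \<Sum>i\<in>I. Ln (1 - f i w)) holomorphic_on D"
    using f(1) less one_minus_notin_nonpos_Reals by (intro holomorphic_intros) blast+
  show "(\<Sum>i\<in>I. Ln (1 - f i 0)) = 0" using f(2) by simp
  fix w assume w: "w \<in> D"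
  have "exp (Ln (1 - f i w)) = 1 - f i w" if "i \<in> I" for i
    using less[OF that w] by (intro exp_Ln) auto
  then show "exp (\<Sum>i\<in>I. Ln (1 - f i w)) = (\<Prod>i\<in>I. 1 - f i w)"
    by (cases "finite I") (simp_all add: exp_sum)
qed

lemma log_branch_Cayley:
  assumes D: "connected D" "0 \<in> D" and u: "u \<in> D"
    and f: "f holomorphic_on D" "f 0 = 0" and less: "\<And>w. w \<in> D \<Longrightarrow> cmod (f w) < 1"
  shows "log_branch D (\<lambda>w. (1 + f w) / (1 - f w)) u = Ln (1 + f u) - Ln (1 - f u)"
proof (rule log_branch_eqI[OF D _ _ _ u])
  have "1 + f w \<notin> \<real>\<^sub>\<le>\<^sub>0" if "w \<in> D" for w
    using one_minus_notin_nonpos_Reals[of "- f w"] less[OF that] by simp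
  then show "(\<lambda>w. Ln (1 + f w) - Ln (1 - f w)) holomorphic_on D"
    using f(1) less one_minus_notin_nonpos_Reals by (intro holomorphic_intros) blast+
  show "Ln (1 + f 0) - Ln (1 - f 0) = 0" using f(2) by simp
  fix w assume w: "w \<in> D"
  have "1 + f w \<noteq> 0" "1 - f w \<noteq> 0"
    using less[OF w] by (auto simp: add_eq_0_iff)
  then show "exp (Ln (1 + f w) - Ln (1 - f w)) = (1 + f w) / (1 - f w)"
    by (simp add: exp_diff)
qed

lemma has_sum_minus_Ln:
  fixes z :: complex
  assumes "cmod z < 1"
  shows "((\<lambda>k. z ^ k / of_nat k) has_sum - Ln (1 - z)) {1..}"
proof -
  have "(\<lambda>k. - (- ((- (- z)) ^ k) / of_nat k)) sums (- Ln (1 + - z))"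
    using assms by (intro sums_minus Ln_series') simp
  then have "(\<lambda>k. z ^ k / of_nat k) sums (- Ln (1 - z))" by simp
  moreover have "summable (\<lambda>k. norm (z ^ k / of_nat k))"
  proof (rule summable_comparison_test')
    show "summable (\<lambda>k. cmod z ^ k)" using assms by (simp add: summable_geometric)
    show "norm (norm (z ^ k / of_nat k)) \<le> cmod z ^ k" if "k \<ge> 1" for k
      using that by (simp add: norm_divide norm_power divide_le_eq mult_le_cancel_left1)
  qed
  ultimately have "((\<lambda>k. z ^ k / of_nat k) has_sum - Ln (1 - z)) UNIV"
    by (intro norm_summable_imp_has_sum)
  then show ?thesis
    by (subst has_sum_cong_neutral[of UNIV "{1..}" _ "\<lambda>k. z ^ k / of_nat k"]) auto
qed

text \<open>Subtracting the series at \<open>- z\<close> from the one at \<open>z\<close> cancels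
  the even terms and doubles the odd ones.\<close>

lemma has_sum_odd_powers:
  fixes z :: complex
  assumes "cmod z < 1"
  shows "((\<lambda>k. z ^ k / of_nat k) has_sum (Ln (1 + z) - Ln (1 - z)) / 2) {k. odd k}"
proof -
  have "((\<lambda>k. z ^ k / of_nat k + - ((- z) ^ k / of_nat k)) has_sum - Ln (1 - z) + - (- Ln (1 - (- z)))) {1..}"
    using assms by (intro has_sum_add has_sum_uminusI has_sum_minus_Ln) auto
  then have "((\<lambda>k. 2 * (z ^ k / of_nat k)) has_sum Ln (1 + z) - Ln (1 - z)) {k. odd k}"
    by (subst has_sum_cong_neutral[of "{1..}" _ "\<lambda>k. z ^ k / of_nat k + - ((- z) ^ k / of_nat k)"])
      (auto simp: odd_pos Suc_leI)
  from has_sum_divide_const[OF this, of 2] show ?thesis by simp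
qed

subsection \<open>The disc of convergence\<close>

lemma nb_disc_le_1: "d \<le> 1 \<Longrightarrow> nb_disc d = UNIV"
  unfolding nb_disc_def by (auto intro!: le_less_trans[OF mult_nonpos_nonneg])

lemma nb_disc_ball: "2 \<le> d \<Longrightarrow> nb_disc d = ball 0 (1 / (real d - 1))"
  unfolding nb_disc_def by (auto simp: field_simps)

lemma zero_in_nb_disc: "0 \<in> nb_disc d"
  unfolding nb_disc_def by simp

lemma connected_nb_disc: "connected (nb_disc d)"
  by (cases "d \<le> 1") (auto simp: nb_disc_le_1 nb_disc_ball intro: convex_connected)

lemma norm_less_1_if_in_nb_disc: "w \<in> nb_disc d \<Longrightarrow> 2 \<le> d \<Longrightarrow> cmod w < 1"
  unfolding nb_disc_def by (auto intro: le_less_trans[OF mult_right_mono[of 1 "real d - 1" "cmod w", simplified]])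

text \<open>For \<open>d \<ge> 2\<close> the region lies inside the unit disc, where squaring
  decreases the modulus; for \<open>d \<le> 1\<close> it is the whole plane.\<close>

lemma square_in_nb_disc:
  assumes "w \<in> nb_disc d" shows "w\<^sup>2 \<in> nb_disc d"
proof (cases "d \<le> 1")
  case False
  then have "cmod (w\<^sup>2) \<le> cmod w"
    using norm_less_1_if_in_nb_disc[OF assms]
    by (simp add: norm_mult power2_eq_square mult_left_le)
  then have "(real d - 1) * cmod (w\<^sup>2) \<le> (real d - 1) * cmod w"
    using False by (intro mult_left_mono) auto
  then show ?thesis using assms by (simp add: nb_disc_def)
qed (simp add: nb_disc_le_1)

subsection \<open>Expansion over closed non-backtracking walks\<close>

lemma has_sum_finite_sum:
  fixes f :: "'i \<Rightarrow> 'b \<Rightarrow> 'c::topological_comm_monoid_add"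
  assumes "finite I" "\<And>i. i \<in> I \<Longrightarrow> (f i has_sum S i) A"
  shows "((\<lambda>x. \<Sum>i\<in>I. f i x) has_sum (\<Sum>i\<in>I. S i)) A"
  using assms by (induction I) (auto intro!: has_sum_0 has_sum_add)

lemma sum_nth_lists:
  assumes "distinct es"
  shows "(\<Sum>xs | set xs \<subseteq> {..<length es} \<and> length xs = k. f (map ((!) es) xs)) =
    (\<Sum>p | set p \<subseteq> set es \<and> length p = k. f p)"
proof (rule sum.reindex_bij_betw)
  have es: "bij_betw ((!) es) {..<length es} (set es)" using assms by (rule bij_betw_nth) auto
  show "bij_betw (map ((!) es)) {xs. set xs \<subseteq> {..<length es} \<and> length xs = k} {p. set p \<subseteq> set es \<and> length p = k}"
  proof (rule bij_betw_imageI)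
    show "inj_on (map ((!) es)) {xs. set xs \<subseteq> {..<length es} \<and> length xs = k}"
      using bij_betw_imp_inj_on[OF es] by (intro inj_on_mapI) (auto elim!: inj_on_subset)
    have lists: "map ((!) es) ` lists {..<length es} = lists (set es)"
      using bij_betw_imp_surj_on[OF es] by (simp flip: lists_image)
    show "map ((!) es) ` {xs. set xs \<subseteq> {..<length es} \<and> length xs = k} =
        {p. set p \<subseteq> set es \<and> length p = k}"
    proof (intro subset_antisym subsetI)
      fix p assume p: "p \<in> {p. set p \<subseteq> set es \<and> length p = k}"
      then have "p \<in> map ((!) es) ` lists {..<length es}" unfolding lists by auto
      with p show "p \<in> map ((!) es) ` {xs. set xs \<subseteq> {..<length es} \<and> length xs = k}"
        by (auto simp: lists_eq_set)
    qed (auto intro!: nth_mem)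
  qed
qed

lemma prod_list_nth: "(\<Prod>t<length p. f (p ! t)) = (\<Prod>a\<leftarrow>p. f a)"
  by (induction p) (auto simp: prod.lessThan_Suc_shift simp del: prod.lessThan_Suc)

text \<open>The matrix puts the sign on the arc being entered, so the signs along a closed walk are
  collected shifted by one place.\<close>

lemma prod_cyclic_shift:
  fixes f :: "'b \<Rightarrow> 'c::comm_monoid_mult"
  shows "(\<Prod>t<length p. f (p ! (Suc t mod length p))) = (\<Prod>a\<leftarrow>p. f a)"
proof -
  have "(\<Prod>t<length p. f (p ! (Suc t mod length p))) = (\<Prod>t<length (rotate1 p). f (rotate1 p ! t))"
    by (intro prod.cong) (auto simp: nth_rotate1)
  also have "\<dots> = (\<Prod>a\<leftarrow>p. f a)"
    unfolding prod_list_nth by (cases p) (auto simp: mult.commute)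
  finally show ?thesis .
qed

section \<open>Degree counts, walk traces and the expansion of the logarithm in a regular
  graph\<close>

locale regular_arcs =
  fixes V :: "'a set" and E :: "'a set set" and d :: nat and es :: "('a \<times> 'a) list"
  assumes simple: "simple_graph V E" and regular: "regular_graph V E d"
    and distinct_es: "distinct es" and set_es: "set es = arcs E"
begin

abbreviation "nb_walks \<equiv> {p. closed_nb_walk E p}"

definition nb_walks_of_length :: "nat \<Rightarrow> ('a \<times> 'a) list set" where
  "nb_walks_of_length k = {p. closed_nb_walk E p \<and> length p = k}"

definition walk_sign :: "('a set \<Rightarrow> bit) \<Rightarrow> ('a \<times> 'a) list \<Rightarrow> complex" where
  "walk_sign s p = pm_one (edge_dot E s (edge_parity p))"

lemma walk_sign_0 [simp]: "walk_sign 0 p = 1"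
  by (simp add: walk_sign_def edge_dot_def)

lemma norm_walk_sign [simp]: "cmod (walk_sign s p) = 1"
  by (simp add: walk_sign_def)

lemma closed_nb_walk_imp_closed_walk: "closed_nb_walk E p \<Longrightarrow> closed_walk E p"
  by (simp add: closed_nb_walk_def)

lemma finite_nb_walks_of_length: "finite (nb_walks_of_length k)"
proof -
  have "finite {p. set p \<subseteq> arcs E \<and> length p = k}"
    unfolding set_es[symmetric] by (rule finite_lists_length_eq) simp
  then show ?thesis
    by (rule rev_finite_subset) (auto simp: nb_walks_of_length_def closed_nb_walk_iff)
qed

lemma card_neighbours:
  assumes "y \<in> V" shows "card {z. {y, z} \<in> E} = d"
proof -
  have "bij_betw (\<lambda>z. {y, z}) {z. {y, z} \<in> E} {e \<in> E. y \<in> e}"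
  proof (rule bij_betw_imageI)
    show "inj_on (\<lambda>z. {y, z}) {z. {y, z} \<in> E}" by (auto intro!: inj_onI simp: doubleton_eq_iff)
    have "\<exists>z. e = {y, z}" if "e \<in> E" "y \<in> e" for e
    proof -
      have "card e = 2" using simple that(1) by (simp add: simple_graph_def)
      then show ?thesis using that(2) by (auto simp: card_2_iff)
    qed
    then show "(\<lambda>z. {y, z}) ` {z. {y, z} \<in> E} = {e \<in> E. y \<in> e}" by blast
  qed
  then show ?thesis using regular assms by (auto simp: regular_graph_def dest: bij_betw_same_card)
qed

lemma card_successors:
  assumes "a \<in> arcs E"
  shows "real (card {b \<in> arcs E. nb_step a b}) = real d - 1"
proof -
  obtain x y where a: "a = (x, y)" "{x, y} \<in> E" using assms by (auto simp: arcs_def)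
  then have V: "x \<in> V" "y \<in> V" using simple by (auto simp: simple_graph_def)
  let ?N = "{z. {y, z} \<in> E}"
  have "finite ?N"
    by (rule finite_subset[of _ V]) (use simple in \<open>auto simp: simple_graph_def\<close>)
  moreover have x: "x \<in> ?N" using a by (simp add: insert_commute)
  \<comment> \<open>A positive degree makes the truncated difference \<open>d - 1\<close> agree with
    the real one.\<close>
  ultimately have "0 < card ?N" by (auto simp: card_gt_0_iff)
  have "{b \<in> arcs E. nb_step a b} = Pair y ` (?N - {x})"
    using a by (auto simp: arcs_def nb_step_def)
  then have "card {b \<in> arcs E. nb_step a b} = card (?N - {x})"
    by (simp add: card_image inj_on_def)
  also have "\<dots> = d - 1" using x \<open>finite ?N\<close> card_neighbours[OF V(2)] by simp
  finally show ?thesis using \<open>0 < card ?N\<close> card_neighbours[OF V(2)] by simp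
qed

text \<open>An arc of such a walk has a successor, while every arc has \<open>d - 1\<close> of them.
  So once a prime exists, the region of \<open>u\<close> lies in the unit disc.\<close>

lemma two_le_degree_if_nb_walk:
  assumes "closed_nb_walk E p" shows "2 \<le> d"
proof -
  have "0 < length p" using assms by (simp add: closed_nb_walk_iff)
  have p: "p ! 0 \<in> arcs E" "p ! (Suc 0 mod length p) \<in> arcs E" "nb_step (p ! 0) (p ! (Suc 0 mod length p))"
    using assms \<open>0 < length p\<close> mod_less_divisor[OF \<open>0 < length p\<close>, of "Suc 0"]
    unfolding closed_nb_walk_iff cyclic_chain_def by (blast intro: subsetD[OF _ nth_mem])+
  have "finite (arcs E)" unfolding set_es[symmetric] by simp
  then have "0 < card {b \<in> arcs E. nb_step (p ! 0) b}"
    unfolding card_gt_0_iff using p by (blast intro: finite_subset)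
  then show ?thesis using card_successors[OF p(1)] by linarith
qed

lemma nb_matrix_row_sum:
  assumes "i < length es"
  shows "(\<Sum>j<length es. cmod (nb_matrix es s $$ (i, j))) = real d - 1"
proof -
  have es: "bij_betw ((!) es) {..<length es} (arcs E)"
    using distinct_es set_es by (intro bij_betw_nth) auto
  have "(\<Sum>j<length es. cmod (nb_matrix es s $$ (i, j))) = (\<Sum>j<length es. of_bool (nb_step (es ! i) (es ! j)))"
    using assms by (intro sum.cong) (auto simp: nb_matrix_def)
  also have "\<dots> = (\<Sum>b\<in>arcs E. of_bool (nb_step (es ! i) b))"
    by (rule sum.reindex_bij_betw[OF es])
  also have "\<dots> = real (card {b \<in> arcs E. nb_step (es ! i) b})"
    using set_es by (subst sum_of_bool_eq) (auto simp: Int_def simp flip: set_es)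
  also have "\<dots> = real d - 1" using assms set_es by (intro card_successors) auto
  finally show ?thesis .
qed

text \<open>A product in the trace expansion vanishes unless the word is a cyclic non-backtracking
  chain, and then it is the product of the edge signs.\<close>

lemma trace_nb_matrix_power:
  assumes "0 < k"
  shows "(\<Sum>i<length es. (nb_matrix es s ^\<^sub>m k) $$ (i, i)) = (\<Sum>p\<in>nb_walks_of_length k. walk_sign s p)"
proof -
  let ?pm = "\<lambda>a. pm_one (s (undir_edge a))"
  let ?w = "\<lambda>i j. if nb_step (es ! i) (es ! j) then ?pm (es ! j) else 0"
  let ?F = "\<lambda>p. \<Prod>t<length p. if nb_step (p ! t) (p ! (Suc t mod length p)) then ?pm (p ! (Suc t mod length p)) else 0"
  let ?L = "{p. set p \<subseteq> arcs E \<and> length p = k}"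
  have F: "?F p = (if cyclic_chain nb_step p then walk_sign s p else 0)" if "set p \<subseteq> arcs E" for p
  proof (cases "cyclic_chain nb_step p")
    case True
    then have "?F p = (\<Prod>t<length p. ?pm (p ! (Suc t mod length p)))"
      by (intro prod.cong) (auto simp: cyclic_chain_def)
    also have "\<dots> = (\<Prod>a\<leftarrow>p. ?pm a)" by (rule prod_cyclic_shift)
    also have "\<dots> = walk_sign s p"
      using edge_dot_edge_parity[OF finite_edges[OF simple] that]
      by (simp add: walk_sign_def prod_list_pm_one)
    finally show ?thesis using True by simp
  next
    case False
    then show ?thesis by (auto simp: cyclic_chain_def)
  qed
  have fin: "finite ?L" unfolding set_es[symmetric] by (rule finite_lists_length_eq) simp
  have "(\<Sum>i<length es. (nb_matrix es s ^\<^sub>m k) $$ (i, i)) =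
      (\<Sum>xs | set xs \<subseteq> {..<length es} \<and> length xs = k. \<Prod>t<k. ?w (xs ! t) (xs ! (Suc t mod k)))"
    unfolding nb_matrix_def by (rule trace_pow_mat[OF assms])
  also have "\<dots> = (\<Sum>xs | set xs \<subseteq> {..<length es} \<and> length xs = k. ?F (map ((!) es) xs))"
    using assms by (intro sum.cong prod.cong refl) (auto intro!: prod.cong)
  also have "\<dots> = (\<Sum>p\<in>?L. ?F p)" using sum_nth_lists[OF distinct_es, of ?F k] set_es by simp
  also have "\<dots> = (\<Sum>p\<in>?L. if cyclic_chain nb_step p then walk_sign s p else 0)"
    by (intro sum.cong refl F) simp
  also have "\<dots> = (\<Sum>p\<in>{p\<in>?L. cyclic_chain nb_step p}. walk_sign s p)"
    using fin by (rule sum.inter_filter[symmetric])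
  also have "{p\<in>?L. cyclic_chain nb_step p} = nb_walks_of_length k"
    using assms by (auto simp: nb_walks_of_length_def closed_nb_walk_iff)
  finally show ?thesis .
qed

text \<open>The maximum keeps the bound non-negative for \<open>d = 0\<close>, where
  \<open>real d - 1\<close> is negative.\<close>

definition growth :: real where "growth = max 0 (real d - 1)"

text \<open>Rows have absolute sum \<open>d - 1\<close>, which bounds the eigenvalues. One family
  \<open>l\<close> then governs both the determinant and the signed walk counts.\<close>

lemma nb_det_eigenvalues:
  "\<exists>l. (\<forall>i<length es. cmod (l i) \<le> growth) \<and>
     (\<forall>w. nb_det es s w = (\<Prod>i<length es. 1 - w * l i)) \<and>
     (\<forall>k>0. (\<Sum>p\<in>nb_walks_of_length k. walk_sign s p) = (\<Sum>i<length es. l i ^ k))"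
proof -
  have carrier: "nb_matrix es s \<in> carrier_mat (length es) (length es)" by (simp add: nb_matrix_def)
  have row: "(\<Sum>j<length es. cmod (nb_matrix es s $$ (i, j))) \<le> growth" if "i < length es" for i
    using nb_matrix_row_sum[OF that] by (simp add: growth_def)
  show ?thesis
  proof (rule det_and_traces_via_eigenvalues[OF carrier row])
    fix l assume l: "\<And>i. i < length es \<Longrightarrow> cmod (l i) \<le> growth"
      "\<And>u. Determinant.det (1\<^sub>m (length es) + (- u) \<cdot>\<^sub>m nb_matrix es s) = (\<Prod>i<length es. 1 - u * l i)"
      "\<And>k. (\<Sum>i<length es. (nb_matrix es s ^\<^sub>m k) $$ (i, i)) = (\<Sum>i<length es. l i ^ k)"
    show ?thesis
    proof (intro exI[of _ l] conjI allI impI)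
      show "nb_det es s w = (\<Prod>i<length es. 1 - w * l i)" for w
        unfolding nb_det_def by (rule l(2))
      show "(\<Sum>p\<in>nb_walks_of_length k. walk_sign s p) = (\<Sum>i<length es. l i ^ k)" if "0 < k" for k
        using trace_nb_matrix_power[OF that] l(3) by metis
    qed (rule l(1))
  qed simp
qed

text \<open>For the zero signing every sign is 1, so the trace identity counts the walks and the
  eigenvalue bound applies.\<close>

lemma card_nb_walks_of_length:
  assumes "0 < k"
  shows "real (card (nb_walks_of_length k)) \<le> length es * growth ^ k"
proof -
  obtain l where "(\<forall>i<length es. cmod (l i) \<le> growth) \<and>
     (\<forall>w. nb_det es 0 w = (\<Prod>i<length es. 1 - w * l i)) \<and>
     (\<forall>k>0. (\<Sum>p\<in>nb_walks_of_length k. walk_sign 0 p) = (\<Sum>i<length es. l i ^ k))"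
    using nb_det_eigenvalues by blast
  then have l: "\<And>i. i < length es \<Longrightarrow> cmod (l i) \<le> growth"
    "\<And>w. nb_det es 0 w = (\<Prod>i<length es. 1 - w * l i)"
    "\<And>k. 0 < k \<Longrightarrow> (\<Sum>p\<in>nb_walks_of_length k. walk_sign 0 p) = (\<Sum>i<length es. l i ^ k)"
    by blast+
  have "real (card (nb_walks_of_length k)) = cmod (\<Sum>i<length es. l i ^ k)"
    using l(3)[OF assms, symmetric] by simp
  also have "\<dots> \<le> (\<Sum>i<length es. growth ^ k)"
    using l(1) by (intro sum_norm_le) (auto simp: norm_power intro: power_mono)
  finally show ?thesis by simp
qed

lemma growth_times_norm_less_1: "x \<in> nb_disc d \<Longrightarrow> growth * cmod x < 1"
  by (auto simp: growth_def nb_disc_def max_def)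

lemma bij_betw_nb_walks_by_length:
  "bij_betw snd (Sigma {1..} nb_walks_of_length) nb_walks"
proof (rule bij_betw_byWitness[where f' = "\<lambda>p. (length p, p)"])
  show "(\<lambda>p. (length p, p)) ` nb_walks \<subseteq> Sigma {1..} nb_walks_of_length"
    by (auto simp: nb_walks_of_length_def closed_nb_walk_iff Suc_le_eq)
qed (auto simp: nb_walks_of_length_def)

text \<open>After discarding coefficients and denominators, grouping by length leaves a series
  dominated by a geometric one of ratio \<open>growth * cmod x\<close>.\<close>

lemma summable_on_nb_walks:
  assumes x: "x \<in> nb_disc d" and c: "\<And>p. cmod (c p) \<le> 1"
  shows "(\<lambda>p. c p * x ^ length p / of_nat (length p)) summable_on nb_walks"
proof -
  have "(\<lambda>(k, p). cmod x ^ k) summable_on Sigma {1..} nb_walks_of_length"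
  proof (rule summable_on_SigmaI)
    show "((\<lambda>p. case (k, p) of (k, p) \<Rightarrow> cmod x ^ k) has_sum card (nb_walks_of_length k) * cmod x ^ k)
        (nb_walks_of_length k)" for k
      by (intro has_sum_finiteI finite_nb_walks_of_length) simp
    have "(\<lambda>k. length es * (growth * cmod x) ^ k) summable_on {1..}"
      using growth_times_norm_less_1[OF x]
      by (intro summable_on_cmult_right has_sum_imp_summable[OF has_sum_geometric_from_1])
        (auto simp: growth_def)
    then show "(\<lambda>k. card (nb_walks_of_length k) * cmod x ^ k) summable_on {1..}"
      by (rule summable_on_comparison_test)
        (auto simp: power_mult_distrib mult.assoc[symmetric] intro!: mult_right_mono card_nb_walks_of_length)
  qed auto
  also have "?this \<longleftrightarrow> (\<lambda>p. cmod x ^ length (snd p)) summable_on Sigma {1..} nb_walks_of_length"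
    by (rule summable_on_cong) (auto simp: nb_walks_of_length_def)
  also have "\<dots> \<longleftrightarrow> (\<lambda>p. cmod x ^ length p) summable_on nb_walks"
    by (rule summable_on_reindex_bij_betw[OF bij_betw_nb_walks_by_length])
  finally have "(\<lambda>p. norm (c p * x ^ length p / of_nat (length p))) summable_on nb_walks"
  proof (rule Infinite_Sum.abs_summable_on_comparison_test')
    fix p assume "p \<in> nb_walks"
    then have "1 \<le> real (length p)" by (auto simp: closed_nb_walk_iff Suc_le_eq)
    have "cmod (c p * x ^ length p / of_nat (length p)) = cmod (c p) * cmod x ^ length p / length p"
      by (simp add: norm_divide norm_mult norm_power)
    also have "\<dots> \<le> 1 * cmod x ^ length p / 1"
      using c[of p] \<open>1 \<le> real (length p)\<close> by (intro frac_le mult_right_mono) auto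
    finally show "cmod (c p * x ^ length p / of_nat (length p)) \<le> cmod x ^ length p" by simp
  qed
  then show ?thesis by (rule Infinite_Sum.abs_summable_summable)
qed

text \<open>Each \<open>Ln (1 - \<phi> u * l i)\<close> is expanded; the terms of exponent
  \<open>k\<close> add up to a power sum of the \<open>l i\<close>, which is the signed count of
  walks of length \<open>k\<close>. Summability over all walks justifies the regrouping. The map
  \<open>\<phi>\<close> allows both the identity and squaring.\<close>

lemma has_sum_log_nb_det:
  assumes \<phi>: "\<phi> holomorphic_on nb_disc d" "\<phi> 0 = 0" "\<And>w. w \<in> nb_disc d \<Longrightarrow> \<phi> w \<in> nb_disc d"
    and u: "u \<in> nb_disc d"
  shows "((\<lambda>p. walk_sign s p * \<phi> u ^ length p / of_nat (length p)) has_sum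
    - log_branch (nb_disc d) (\<lambda>w. nb_det es s (\<phi> w)) u) nb_walks"
proof -
  obtain l where "(\<forall>i<length es. cmod (l i) \<le> growth) \<and>
     (\<forall>w. nb_det es s w = (\<Prod>i<length es. 1 - w * l i)) \<and>
     (\<forall>k>0. (\<Sum>p\<in>nb_walks_of_length k. walk_sign s p) = (\<Sum>i<length es. l i ^ k))"
    using nb_det_eigenvalues by blast
  then have l: "\<And>i. i < length es \<Longrightarrow> cmod (l i) \<le> growth"
    "\<And>w. nb_det es s w = (\<Prod>i<length es. 1 - w * l i)"
    "\<And>k. 0 < k \<Longrightarrow> (\<Sum>p\<in>nb_walks_of_length k. walk_sign s p) = (\<Sum>i<length es. l i ^ k)"
    by blast+
  have less: "cmod (\<phi> w * l i) < 1" if "i < length es" "w \<in> nb_disc d" for i w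
  proof -
    have "cmod (\<phi> w * l i) \<le> cmod (\<phi> w) * growth"
      unfolding norm_mult using l(1)[OF that(1)] by (rule mult_left_mono) simp
    then show ?thesis using growth_times_norm_less_1[OF \<phi>(3)[OF that(2)]] by (simp add: mult.commute)
  qed
  let ?x = "\<phi> u" and ?S = "- log_branch (nb_disc d) (\<lambda>w. nb_det es s (\<phi> w)) u"
  let ?f = "\<lambda>p. walk_sign s p * ?x ^ length p / of_nat (length p)"
  have S: "?S = (\<Sum>i<length es. - Ln (1 - ?x * l i))"
    unfolding l(2) sum_negf using \<phi>(1,2) less
    by (subst log_branch_prod[OF connected_nb_disc zero_in_nb_disc u]) (auto intro!: holomorphic_intros)
  have "((\<lambda>y. ?f (snd y)) has_sum ?S) (Sigma {1..} nb_walks_of_length)"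
  proof (rule has_sum_SigmaI)
    fix k :: nat assume k: "k \<in> {1..}"
    have "(\<Sum>p\<in>nb_walks_of_length k. ?f p) = (\<Sum>p\<in>nb_walks_of_length k. walk_sign s p * (?x ^ k / of_nat k))"
      by (rule sum.cong) (auto simp: nb_walks_of_length_def)
    also have "\<dots> = (\<Sum>i<length es. (?x * l i) ^ k / of_nat k)"
      unfolding sum_distrib_right[symmetric] using k
      by (subst l(3)) (auto simp: sum_distrib_left sum_divide_distrib power_mult_distrib mult.commute)
    finally have "(\<Sum>p\<in>nb_walks_of_length k. ?f p) = (\<Sum>i<length es. (?x * l i) ^ k / of_nat k)" .
    then show "((\<lambda>p. ?f (snd (k, p))) has_sum (\<Sum>i<length es. (?x * l i) ^ k / of_nat k)) (nb_walks_of_length k)"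
      by (intro has_sum_finiteI finite_nb_walks_of_length) simp
  next
    show "((\<lambda>k. \<Sum>i<length es. (?x * l i) ^ k / of_nat k) has_sum ?S) {1..}"
      unfolding S using less u by (intro has_sum_finite_sum has_sum_minus_Ln) auto
    have "?f summable_on nb_walks" using \<phi>(3)[OF u] by (intro summable_on_nb_walks) auto
    then show "(\<lambda>y. ?f (snd y)) summable_on Sigma {1..} nb_walks_of_length"
      by (subst summable_on_reindex_bij_betw[OF bij_betw_nb_walks_by_length])
  qed
  then show ?thesis
    by (subst (asm) has_sum_reindex_bij_betw[OF bij_betw_nb_walks_by_length])
qed

section \<open>Switching invariance and averaging of the expansion\<close>

lemma log_nb_det_switching_rel:
  assumes "(s, s') \<in> switching_rel V E" "u \<in> nb_disc d"
  shows "log_branch (nb_disc d) (nb_det es s') u = log_branch (nb_disc d) (nb_det es s) u"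
proof -
  have sum: "((\<lambda>p. walk_sign s p * u ^ length p / of_nat (length p)) has_sum
      - log_branch (nb_disc d) (nb_det es s) u) nb_walks" for s
    using has_sum_log_nb_det[of "\<lambda>w. w" u s] assms(2) by simp
  \<comment> \<open>The expansion determines the logarithm, and its coefficients depend only on the
    switching class.\<close>
  have "walk_sign s' p = walk_sign s p" if "p \<in> nb_walks" for p
    using edge_dot_switching_rel[OF simple _ assms(1)] that
    by (simp add: walk_sign_def closed_nb_walk_imp_closed_walk)
  then have "((\<lambda>p. walk_sign s' p * u ^ length p / of_nat (length p)) has_sum S) nb_walks \<longleftrightarrow>
      ((\<lambda>p. walk_sign s p * u ^ length p / of_nat (length p)) has_sum S) nb_walks" for S
    by (intro has_sum_cong) simp
  with sum[of s'] have "((\<lambda>p. walk_sign s p * u ^ length p / of_nat (length p)) has_sum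
      - log_branch (nb_disc d) (nb_det es s') u) nb_walks"
    by blast
  from has_sum_unique[OF sum[of s] this] show ?thesis by simp
qed

lemma has_sum_average_log_nb_det:
  assumes u: "u \<in> nb_disc d"
  shows "((\<lambda>p. average (solution_classes V E L) (class_value (\<lambda>s. walk_sign s p)) *
       u ^ length p / of_nat (length p)) has_sum
    - average (solution_classes V E L) (class_value (\<lambda>s. log_branch (nb_disc d) (nb_det es s) u))) nb_walks"
proof -
  let ?A = "solution_classes V E L" and ?lb = "\<lambda>s. log_branch (nb_disc d) (nb_det es s) u"
  have "((\<lambda>p. \<Sum>c\<in>?A. class_value (\<lambda>s. walk_sign s p) c * (u ^ length p / of_nat (length p))) has_sum
      (\<Sum>c\<in>?A. - class_value ?lb c)) nb_walks"
  proof (rule has_sum_finite_sum)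
    show "finite ?A" by (intro finite_solution_classes finite_edges[OF simple])
    fix c assume "c \<in> ?A"
    then obtain s where c: "c = switching_rel V E `` {s}"
      unfolding solution_classes_def by (auto elim: quotientE)
    have lb: "class_value ?lb c = ?lb s"
      unfolding c using u by (intro class_value_switching_class log_nb_det_switching_rel)
    have "class_value (\<lambda>s. walk_sign s p) c = walk_sign s p" if "p \<in> nb_walks" for p
      unfolding c using that
      by (intro class_value_switching_class)
        (simp add: walk_sign_def edge_dot_switching_rel[OF simple] closed_nb_walk_imp_closed_walk)
    then have "((\<lambda>p. class_value (\<lambda>s. walk_sign s p) c * (u ^ length p / of_nat (length p))) has_sum S) nb_walks
        \<longleftrightarrow> ((\<lambda>p. walk_sign s p * (u ^ length p / of_nat (length p))) has_sum S) nb_walks" for S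
      by (intro has_sum_cong) simp
    moreover have "((\<lambda>p. walk_sign s p * (u ^ length p / of_nat (length p))) has_sum - ?lb s) nb_walks"
      using has_sum_log_nb_det[of "\<lambda>w. w" u s] u by simp
    ultimately show "((\<lambda>p. class_value (\<lambda>s. walk_sign s p) c * (u ^ length p / of_nat (length p))) has_sum
        - class_value ?lb c) nb_walks"
      unfolding lb by blast
  qed
  from has_sum_divide_const[OF this, of "of_nat (card ?A)"] show ?thesis
    by (simp add: average_def sum_negf ac_simps flip: sum_distrib_left sum_distrib_right sum_divide_distrib)
qed


section \<open>Separating even from odd powers of primitive walks\<close>

lemma has_sum_over_odd_powers:
  assumes c: "\<And>p. cmod (c p) \<le> 1"
    and even: "\<And>p m. even m \<Longrightarrow> c (concat (replicate m p)) = 1"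
    and u: "u \<in> nb_disc d"
    and S: "((\<lambda>p. c p * u ^ length p / of_nat (length p)) has_sum S) nb_walks"
  shows "((\<lambda>(p, m). c (concat (replicate m p)) * u ^ (m * length p) / of_nat (m * length p)) has_sum
     S + 1 / 2 * log_branch (nb_disc d) (\<lambda>w. nb_det es 0 (w\<^sup>2)) u)
     (primitive_nb_walks E \<times> {m. odd m})"
proof -
  let ?Q = "primitive_nb_walks E"
  let ?f = "\<lambda>(p, m). c (concat (replicate m p)) * u ^ (m * length p) / of_nat (m * length p)"
  define LB where "LB = log_branch (nb_disc d) (\<lambda>w. nb_det es 0 (w\<^sup>2)) u"
  have "((\<lambda>x. c (case x of (p, m) \<Rightarrow> concat (replicate m p)) * u ^ length (case x of (p, m) \<Rightarrow> concat (replicate m p)) /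
      of_nat (length (case x of (p, m) \<Rightarrow> concat (replicate m p)))) has_sum S) (?Q \<times> {1..})"
    using S by (subst has_sum_reindex_bij_betw[OF bij_betw_primitive_power])
  also have "?this \<longleftrightarrow> (?f has_sum S) (?Q \<times> {1..})"
    by (rule has_sum_cong) auto
  finally have all: "(?f has_sum S) (?Q \<times> {1..})" .
  \<comment> \<open>The walk expansion for the zero signing at the square of \<open>u\<close>: its
    term at the \<open>m\<close>-th power of \<open>p\<close>, halved, is the term of
    \<open>?f\<close> at \<open>(p, 2 * m)\<close>.\<close>
  have "((\<lambda>p. walk_sign 0 p * (u\<^sup>2) ^ length p / of_nat (length p)) has_sum - LB) nb_walks"
    unfolding LB_def using u
    by (intro has_sum_log_nb_det) (auto intro!: holomorphic_intros square_in_nb_disc)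
  then have "((\<lambda>x. walk_sign 0 (case x of (p, m) \<Rightarrow> concat (replicate m p)) *
       (u\<^sup>2) ^ length (case x of (p, m) \<Rightarrow> concat (replicate m p)) /
      of_nat (length (case x of (p, m) \<Rightarrow> concat (replicate m p)))) has_sum - LB) (?Q \<times> {1..})"
    by (subst has_sum_reindex_bij_betw[OF bij_betw_primitive_power])
  from has_sum_divide_const[OF this, of 2]
  have "((\<lambda>x. walk_sign 0 (case x of (p, m) \<Rightarrow> concat (replicate m p)) *
       (u\<^sup>2) ^ length (case x of (p, m) \<Rightarrow> concat (replicate m p)) /
      of_nat (length (case x of (p, m) \<Rightarrow> concat (replicate m p))) / 2) has_sum - LB / 2) (?Q \<times> {1..})" .
  also have "?this \<longleftrightarrow> ((\<lambda>x. ?f (case x of (p, m) \<Rightarrow> (p, 2 * m))) has_sum - LB / 2) (?Q \<times> {1..})"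
  proof (rule has_sum_cong)
    fix x assume "x \<in> ?Q \<times> {1::nat..}"
    have "c (concat (replicate (2 * m) p)) = 1" for p m by (rule even) simp
    then show "walk_sign 0 (case x of (p, m) \<Rightarrow> concat (replicate m p)) *
       (u\<^sup>2) ^ length (case x of (p, m) \<Rightarrow> concat (replicate m p)) /
      of_nat (length (case x of (p, m) \<Rightarrow> concat (replicate m p))) / 2 = ?f (case x of (p, m) \<Rightarrow> (p, 2 * m))"
      by (cases x) (simp add: power_mult[symmetric] ac_simps)
  qed
  also have "\<dots> \<longleftrightarrow> (?f has_sum - LB / 2) (?Q \<times> {m. even m \<and> 0 < m})"
  proof (rule has_sum_reindex_bij_betw)
    show "bij_betw (\<lambda>(p, m). (p, 2 * m)) (?Q \<times> {1..}) (?Q \<times> {m. even m \<and> 0 < (m::nat)})"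
      by (rule bij_betw_byWitness[where f' = "\<lambda>(p, m). (p, m div 2)"]) auto
  qed
  finally have evens: "(?f has_sum - LB / 2) (?Q \<times> {m. even m \<and> 0 < m})" .
  \<comment> \<open>The odd part is summable as a subfamily; its value is then forced by subtracting
    the even part from \<open>S\<close>.\<close>
  have "?f summable_on ?Q \<times> {m. odd m}"
    by (rule summable_on_subset_banach[OF has_sum_imp_summable[OF all]]) (auto simp: Suc_le_eq odd_pos)
  then obtain R where odds: "(?f has_sum R) (?Q \<times> {m. odd m})" by (auto simp: summable_on_def)
  have split: "?Q \<times> {1::nat..} = ?Q \<times> {m. even m \<and> 0 < m} \<union> ?Q \<times> {m. odd m}"
    by (auto simp: Suc_le_eq odd_pos)
  have "(?f has_sum - LB / 2 + R) (?Q \<times> {1..})"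
    unfolding split by (rule has_sum_Un_disjoint[OF evens odds]) auto
  from has_sum_unique[OF all this] have "R = S + 1 / 2 * LB" by simp
  with odds show ?thesis unfolding LB_def by simp
qed

text \<open>The existence of \<open>p\<close> forces \<open>d \<ge> 2\<close>, hence
  \<open>cmod w < 1\<close> throughout the region, and the principal logarithms of numerator and
  denominator give the branch.\<close>

lemma log_branch_prime_factor:
  assumes p: "p \<in> primitive_nb_walks E" and u: "u \<in> nb_disc d"
  shows "cmod (pm_one b * u ^ length p) < 1"
    and "log_branch (nb_disc d) (\<lambda>w. (1 + pm_one b * w ^ length p) / (1 - pm_one b * w ^ length p)) u =
      Ln (1 + pm_one b * u ^ length p) - Ln (1 - pm_one b * u ^ length p)"
proof -
  have walk: "closed_nb_walk E p" using p by (simp add: primitive_nb_walks_def)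
  then have len: "0 < length p" by (simp add: closed_nb_walk_iff)
  have less: "cmod (pm_one b * w ^ length p) < 1" if "w \<in> nb_disc d" for w
  proof -
    have "cmod w < 1" using norm_less_1_if_in_nb_disc[OF that two_le_degree_if_nb_walk[OF walk]] .
    then show ?thesis using len by (simp add: norm_mult norm_power power_less_one_iff)
  qed
  show "cmod (pm_one b * u ^ length p) < 1" by (rule less[OF u])
  show "log_branch (nb_disc d) (\<lambda>w. (1 + pm_one b * w ^ length p) / (1 - pm_one b * w ^ length p)) u =
      Ln (1 + pm_one b * u ^ length p) - Ln (1 - pm_one b * u ^ length p)"
    using len less by (intro log_branch_Cayley[OF connected_nb_disc zero_in_nb_disc u])
      (auto intro!: holomorphic_intros)
qed

end

section \<open>Regrouping the averaged walk expansion by primes\<close>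

theorem proposition10:
  fixes V :: "'a set" and E :: "'a set set" and d L :: nat
    and es :: "('a \<times> 'a) list"
    and \<pi> :: "('a set \<Rightarrow> bit) \<Rightarrow> bit" and u :: complex
  defines "W \<equiv> constraint_span E L"
    and "D \<equiv> nb_disc d"
    and "\<epsilon> \<equiv> (\<lambda>P. pm_one (\<pi> (traversal_vector P)))"
  defines "PW \<equiv> {P \<in> nb_primes E. traversal_vector P \<in> W}"
    and "T \<equiv> (\<lambda>P. log_branch D
           (\<lambda>w. (1 + \<epsilon> P * w ^ nb_prime_length P) / (1 - \<epsilon> P * w ^ nb_prime_length P)) u)"
  assumes "simple_graph V E" and "connected_graph V E" and "regular_graph V E d"
    and "distinct es" and "set es = arcs E"
    and "0 < L" and "consistent E L"
    and "linear_form_on W \<pi>" and "\<forall>C\<in>constraint_cycles E L. \<pi> (chi C) = 1"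
    and "u \<in> D"
  shows "T summable_on PW \<and>
    average (solution_classes V E L) (class_value (\<lambda>s. log_branch D (nb_det es s) u)) =
      1 / 2 * log_branch D (\<lambda>w. nb_det es 0 (w\<^sup>2)) u - 1 / 2 * infsum T PW"
proof -
  interpret regular_arcs V E d es
    using assms by unfold_locales
  define avg where "avg = average (solution_classes V E L) (class_value (\<lambda>s. log_branch D (nb_det es s) u))"
  define LB where "LB = log_branch D (\<lambda>w. nb_det es 0 (w\<^sup>2)) u"
  \<comment> \<open>The averaged sign of a walk: the sign prescribed by \<open>\<pi>\<close> on
    \<open>W\<close>, and 0 elsewhere.\<close>
  define c :: "('a \<times> 'a) list \<Rightarrow> complex"
    where "c p = (if edge_parity p \<in> W then pm_one (\<pi> (edge_parity p)) else 0)" for p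
  have u: "u \<in> nb_disc d" using assms by simp
  have "average (solution_classes V E L) (class_value (\<lambda>s. walk_sign s p)) = c p" if "p \<in> nb_walks" for p
    unfolding walk_sign_def c_def W_def
    using that assms by (intro average_sign) (auto simp: closed_nb_walk_imp_closed_walk)
  then have "((\<lambda>p. average (solution_classes V E L) (class_value (\<lambda>s. walk_sign s p)) *
       u ^ length p / of_nat (length p)) has_sum - avg) nb_walks \<longleftrightarrow>
      ((\<lambda>p. c p * u ^ length p / of_nat (length p)) has_sum - avg) nb_walks"
    by (intro has_sum_cong) simp
  with has_sum_average_log_nb_det[OF u, of L]
  have walks: "((\<lambda>p. c p * u ^ length p / of_nat (length p)) has_sum - avg) nb_walks"
    unfolding avg_def D_def by blast
  \<comment> \<open>The zero vector, which is the parity vector of every even power, lies in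
    \<open>W\<close>, and \<open>\<pi>\<close> vanishes there; even powers thus have averaged sign
    1.\<close>
  have W0: "0 \<in> W" unfolding W_def constraint_span_def by (rule bitvec.span_zero)
  then have "\<pi> (bit_scale 0 0) = 0 * \<pi> 0"
    using \<open>linear_form_on W \<pi>\<close> unfolding linear_form_on_def by blast
  then have "\<pi> 0 = 0" by (simp add: bit_scale_def zero_fun_def)
  then have c_even: "c (concat (replicate m p)) = 1" if "even m" for p m
    using that W0 by (simp only: c_def edge_parity_concat_replicate if_True pm_one_0)
  have c_odd: "c (concat (replicate m p)) = c p" if "odd m" for p m
    using that by (simp only: c_def edge_parity_concat_replicate if_False)
  have c_norm: "cmod (c p) \<le> 1" for p by (simp add: c_def)
  \<comment> \<open>The logarithm attached to the prime of \<open>p\<close>, written with principal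
    logarithms and extended by 0 to walks outside the sum.\<close>
  define t where "t p = (if edge_parity p \<in> W then
      Ln (1 + pm_one (\<pi> (edge_parity p)) * u ^ length p) - Ln (1 - pm_one (\<pi> (edge_parity p)) * u ^ length p)
      else 0)" for p
  have "((\<lambda>p. t p / 2 / of_nat (length p)) has_sum - avg + 1 / 2 * LB) (primitive_nb_walks E)"
  proof (rule has_sum_SigmaD)
    show "((\<lambda>(p, m). c (concat (replicate m p)) * u ^ (m * length p) / of_nat (m * length p)) has_sum
        - avg + 1 / 2 * LB) (primitive_nb_walks E \<times> {m. odd m})"
      unfolding LB_def D_def by (rule has_sum_over_odd_powers[OF c_norm c_even u walks])
    fix p assume p: "p \<in> primitive_nb_walks E"
    let ?e = "pm_one (\<pi> (edge_parity p))"
    \<comment> \<open>For odd \<open>m\<close> the sign satisfies \<open>?e ^ m = ?e\<close>, so the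
      odd powers of \<open>p\<close> form the odd logarithmic series at
      \<open>?e * u ^ length p\<close>.\<close>
    have "((\<lambda>m. (?e * u ^ length p) ^ m / of_nat m / of_nat (length p)) has_sum
        (Ln (1 + ?e * u ^ length p) - Ln (1 - ?e * u ^ length p)) / 2 / of_nat (length p)) {m. odd m}"
      by (intro has_sum_divide_const has_sum_odd_powers log_branch_prime_factor(1)[OF p u])
    then have "((\<lambda>m. c p * u ^ (m * length p) / of_nat (m * length p)) has_sum t p / 2 / of_nat (length p)) {m. odd m}"
    proof (cases "edge_parity p \<in> W")
      case True
      have "((\<lambda>m. (?e * u ^ length p) ^ m / of_nat m / of_nat (length p)) has_sum S) {m. odd m} \<longleftrightarrow>
          ((\<lambda>m. c p * u ^ (m * length p) / of_nat (m * length p)) has_sum S) {m. odd m}" for S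
        using True by (intro has_sum_cong)
          (simp add: c_def power_mult_distrib pm_one_power_odd power_mult[symmetric] mult.commute)
      then show ?thesis
        using \<open>((\<lambda>m. (?e * u ^ length p) ^ m / of_nat m / of_nat (length p)) has_sum _) _\<close> True
        by (simp add: t_def)
    qed (simp add: c_def t_def)
    also have "?this \<longleftrightarrow> ((\<lambda>m. case (p, m) of (p, m) \<Rightarrow>
        c (concat (replicate m p)) * u ^ (m * length p) / of_nat (m * length p)) has_sum t p / 2 / of_nat (length p)) {m. odd m}"
      by (intro has_sum_cong) (simp add: c_odd)
    finally show "((\<lambda>m. case (p, m) of (p, m) \<Rightarrow>
        c (concat (replicate m p)) * u ^ (m * length p) / of_nat (m * length p)) has_sum t p / 2 / of_nat (length p)) {m. odd m}" .
  qed
  then have "((\<lambda>x. t (snd x) / 2 / of_nat (length (snd x))) has_sum - avg + 1 / 2 * LB) (Sigma (nb_primes E) (\<lambda>P. P))"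
    by (subst has_sum_reindex_bij_betw[OF bij_betw_nb_primes])
  then have primes: "((\<lambda>P. if P \<in> PW then T P / 2 else 0) has_sum - avg + 1 / 2 * LB) (nb_primes E)"
  proof (rule has_sum_SigmaD)
    fix P assume P: "P \<in> nb_primes E"
    have "t p / 2 / of_nat (length p) = (if P \<in> PW then T P / 2 else 0) / of_nat (card P)" if p: "p \<in> P" for p
    proof -
      have "p \<in> primitive_nb_walks E" using nb_prime_subset[OF P] p by blast
      then show ?thesis
        using P p card_nb_prime(2)[OF P p] log_branch_prime_factor(2)[OF _ u]
        by (simp add: PW_def T_def \<epsilon>_def t_def D_def traversal_vector_eq[OF P p] nb_prime_length_eq[OF P p])
    qed
    \<comment> \<open>The prime \<open>P\<close> has as many members as its length and all
      contribute equally, so the weight \<open>1 / length p\<close> disappears on summing over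
      \<open>P\<close>.\<close>
    then have "(\<Sum>p\<in>P. t p / 2 / of_nat (length p)) = (\<Sum>p\<in>P. (if P \<in> PW then T P / 2 else 0) / of_nat (card P))"
      by (intro sum.cong refl)
    moreover have "finite P" "card P \<noteq> 0"
    proof -
      obtain p where "p \<in> primitive_nb_walks E" "P = rotation_rel `` {p}" using P by (rule nb_primeE)
      then have "p \<in> P" using equiv_class_self[OF equiv_rotation_rel] by blast
      then show "finite P" using card_nb_prime(1)[OF P] by blast
      with \<open>p \<in> P\<close> show "card P \<noteq> 0" by auto
    qed
    ultimately show "((\<lambda>p. t (snd (P, p)) / 2 / of_nat (length (snd (P, p)))) has_sum (if P \<in> PW then T P / 2 else 0)) P"
      by (intro has_sum_finiteI) auto
  qed
  have "((\<lambda>P. if P \<in> PW then T P / 2 else 0) has_sum - avg + 1 / 2 * LB) (nb_primes E) \<longleftrightarrow>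
      ((\<lambda>P. T P / 2) has_sum - avg + 1 / 2 * LB) PW"
    by (rule has_sum_cong_neutral) (auto simp: PW_def)
  with primes have "((\<lambda>P. T P / 2) has_sum - avg + 1 / 2 * LB) PW" by blast
  \<comment> \<open>Doubling removes the factor one half; solving the resulting value for
    \<open>avg\<close> gives the formula.\<close>
  from has_sum_cmult_right[OF this, of 2] have T: "(T has_sum LB - 2 * avg) PW"
    by (simp add: algebra_simps)
  then have "infsum T PW = LB - 2 * avg" by (rule infsumI)
  then have "avg = 1 / 2 * LB - 1 / 2 * infsum T PW" by (simp add: field_simps)
  with has_sum_imp_summable[OF T] show ?thesis unfolding avg_def LB_def by blast
qed

end
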